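(* Suppose that the system $y(t+1)=f(y(t),u(t),\sigma(t))$ satisfies the strong $h$-approximation conditions for every vector function $h=(q_1,\dots,q_j)$, $j=1,2,\dots$. Then there is a function $\bar\nu(T)$ with $\lim_{T\to\infty}\bar\nu(T)=0$ such that $$\sup_{\gamma\in W}\rho^E(\gamma,B_T(y_0))\le\bar\nu(T)\qquad\text{for every initial condition }y_0\in Y.$$
   Context: Setting. $Y\subset\mathbb R^m$ is compact, $\hat U$ and $S$ are compact metric spaces, $f:Y\times\hat U\times S\to\mathbb R^m$ is continuous, and $f(y,u,\sigma)\in Y$ for all $(y,u,\sigma)\in Y\times\hat U\times S$. $\sigma(0),\sigma(1),\dots$ are independent, identically distributed random elements of $S$ on a common probability space; $\sigma$ denotes a random element with their common law. The system is $y(t+1)=f(y(t),u(t),\sigma(t))$, $y(0)=y_0\in Y$, $t=0,1,2,\dots$. A control plan is a sequence $\pi=\{\pi_t\}_{t\ge0}$ with $\pi_0\in\hat U$ and $\pi_t:S^t\to\hat U$ Borel measurable for $t\ge1$; the controls are $u(0)=\pi_0$, $u(t)=\pi_t(\sigma(0),\dots,\sigma(t-1))$. $\Pi$ is the set of all control plans, and $(y^{\pi,y_0}(\cdot),u^{\pi,y_0}(\cdot))$ is the resulting state-control trajectory. Random occupational measures. $\mathcal P(Y\times\hat U)$ is the set of Borel probability measures on $Y\times\hat U$. For a positive integer $T$ and Borel $Q\subset Y\times\hat U$, $\chi^{\pi,y_0,T}(Q)=\frac1T\sum_{t=0}^{T-1}1_Q(y^{\pi,y_0}(t),u^{\pi,y_0}(t))$,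 and $B_T(y_0)=\bigcup_{\pi\in\Pi}\{\chi^{\pi,y_0,T}\}$. Stationary measures. $W=\big\{\gamma\in\mathcal P(Y\times\hat U):\int_{Y\times\hat U}\big(E[\varphi(f(y,u,\sigma))]-\varphi(y)\big)\gamma(dy,du)=0\ \ \forall\varphi\in C(Y)\big\}$. Metrics. $q_1,q_2,\dots$ is a fixed sequence of Lipschitz continuous functions dense in the unit ball of $C(Y\times\hat U)$. $\rho(\gamma',\gamma'')=\sum_{j\ge1}2^{-j}\big|\int q_j\,d\gamma'-\int q_j\,d\gamma''\big|$. For a deterministic $\gamma\in\mathcal P(Y\times\hat U)$ and a collection $\Phi$ of random probability measures on $Y\times\hat U$, $\rho^E(\gamma,\Phi)=\inf_{\gamma'\in\Phi}E[\rho(\gamma,\gamma')]$. Strong $h$-approximation conditions (for a given $h=(q_1,\dots,q_j):Y\times\hat U\to\mathbb R^j$): there is a monotone decreasing $\nu_h:[0,\infty)\to[0,\infty)$ with $\lim_{T\to\infty}\nu_h(T)=0$ such that for all $T$, all $y_0',y_0''\in Y$ and every control plan $\pi'$ there is a control plan $\pi''$ with $E\Big[\Big\|\frac1T\sum_{t=0}^{T}h(y^{\pi',y_0'}(t),u^{\pi',y_0'}(t))-\frac1T\sum_{t=0}^{T}h(y^{\pi'',y_0''}(t),u^{\pi'',y_0''}(t))\Big\|\Big]\le\nu_h(T)$. *)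

theory Defs
  imports "HOL-Probability.Probability"
begin

definition borel_on :: "'a::topological_space set \<Rightarrow> 'a measure" where
  "borel_on X = restrict_space borel X"

text \<open>A point of \<open>S\<^sup>t\<close> is an extensional function on \<open>{..<t}\<close>. As \<open>S\<close> will be a compact metric
  space, the product sigma-algebra is the Borel sigma-algebra of \<open>S\<^sup>t\<close>. For \<open>t = 0\<close> the domain
  has a single point, so that \<open>\<pi> 0\<close> amounts to an element of \<open>U\<close>.\<close>

definition control_plans ::
  "'s::metric_space set \<Rightarrow> 'u::metric_space set \<Rightarrow> (nat \<Rightarrow> (nat \<Rightarrow> 's) \<Rightarrow> 'u) set" where
  "control_plans S U =
     {\<pi>. \<forall>t. \<pi> t \<in> measurable (PiM {..<t} (\<lambda>_. borel_on S)) (borel_on U)}"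

definition control ::
  "(nat \<Rightarrow> 'w \<Rightarrow> 's) \<Rightarrow> (nat \<Rightarrow> (nat \<Rightarrow> 's) \<Rightarrow> 'u) \<Rightarrow> nat \<Rightarrow> 'w \<Rightarrow> 'u" where
  "control \<sigma> \<pi> t \<omega> = \<pi> t (\<lambda>i\<in>{..<t}. \<sigma> i \<omega>)"

primrec state ::
  "('y \<times> 'u \<times> 's \<Rightarrow> 'y) \<Rightarrow> (nat \<Rightarrow> 'w \<Rightarrow> 's) \<Rightarrow> (nat \<Rightarrow> (nat \<Rightarrow> 's) \<Rightarrow> 'u) \<Rightarrow> 'y
     \<Rightarrow> nat \<Rightarrow> 'w \<Rightarrow> 'y" where
  "state f \<sigma> \<pi> y0 0 \<omega> = y0"
| "state f \<sigma> \<pi> y0 (Suc t) \<omega> = f (state f \<sigma> \<pi> y0 t \<omega>, control \<sigma> \<pi> t \<omega>, \<sigma> t \<omega>)"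

definition trajectory ::
  "('y \<times> 'u \<times> 's \<Rightarrow> 'y) \<Rightarrow> (nat \<Rightarrow> 'w \<Rightarrow> 's) \<Rightarrow> (nat \<Rightarrow> (nat \<Rightarrow> 's) \<Rightarrow> 'u) \<Rightarrow> 'y
     \<Rightarrow> nat \<Rightarrow> 'w \<Rightarrow> 'y \<times> 'u" where
  "trajectory f \<sigma> \<pi> y0 t \<omega> = (state f \<sigma> \<pi> y0 t \<omega>, control \<sigma> \<pi> t \<omega>)"

definition occupational_measure ::
  "'y::metric_space set \<Rightarrow> 'u::metric_space set \<Rightarrow> ('y \<times> 'u \<times> 's \<Rightarrow> 'y) \<Rightarrow> (nat \<Rightarrow> 'w \<Rightarrow> 's)
     \<Rightarrow> (nat \<Rightarrow> (nat \<Rightarrow> 's) \<Rightarrow> 'u) \<Rightarrow> 'y \<Rightarrow> nat \<Rightarrow> 'w \<Rightarrow> ('y \<times> 'u) measure" where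
  "occupational_measure Y U f \<sigma> \<pi> y0 T \<omega> =
     measure_of (Y \<times> U) (sets (borel_on (Y \<times> U)))
       (\<lambda>Q. ennreal (1 / real T * (\<Sum>t<T. indicator Q (trajectory f \<sigma> \<pi> y0 t \<omega>))))"

lemma space_borel_on [simp]: "space (borel_on X) = X"
  by (simp add: borel_on_def space_restrict_space)

text \<open>The defining formula is countably additive, so \<open>measure_of\<close> does not fall back to the null
  measure.\<close>

lemma
  shows space_occupational_measure [simp]:
      "space (occupational_measure Y U f \<sigma> \<pi> y0 T \<omega>) = Y \<times> U"
    and sets_occupational_measure [simp]:
      "sets (occupational_measure Y U f \<sigma> \<pi> y0 T \<omega>) = sets (borel_on (Y \<times> U))"
    and emeasure_occupational_measure:
      "Q \<in> sets (borel_on (Y \<times> U)) \<Longrightarrow> emeasure (occupational_measure Y U f \<sigma> \<pi> y0 T \<omega>) Q =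
         ennreal (1 / real T * (\<Sum>t<T. indicator Q (trajectory f \<sigma> \<pi> y0 t \<omega>)))"
proof -
  let ?B = "sets (borel_on (Y \<times> U))"
  let ?x = "\<lambda>t. trajectory f \<sigma> \<pi> y0 t \<omega>"
  let ?m = "\<lambda>Q. ennreal (1 / real T * (\<Sum>t<T. indicator Q (?x t)))"
  have sa: "sigma_algebra (Y \<times> U) ?B"
    using sets.sigma_algebra_axioms[of "borel_on (Y \<times> U)"] by simp
  then interpret sigma_algebra "Y \<times> U" ?B .
  have eq: "?m Q = (\<Sum>t<T. ennreal (1 / real T) * indicator Q (?x t))" for Q
  proof -
    have "?m Q = ennreal (\<Sum>t<T. 1 / real T * indicator Q (?x t))"
      by (simp only: sum_distrib_left)
    also have "\<dots> = (\<Sum>t<T. ennreal (1 / real T * indicator Q (?x t)))"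
      by (subst sum_ennreal) (auto simp: indicator_def)
    also have "\<dots> = (\<Sum>t<T. ennreal (1 / real T) * indicator Q (?x t))"
      by (intro sum.cong) (auto simp: indicator_def)
    finally show ?thesis .
  qed
  have ca: "countably_additive ?B ?m"
    unfolding countably_additive_def eq
  proof (intro allI impI)
    fix A :: "nat \<Rightarrow> ('a \<times> 'b) set" assume d: "disjoint_family A"
    have "(\<Sum>i. \<Sum>t<T. ennreal (1 / real T) * indicator (A i) (?x t)) =
        (\<Sum>t<T. \<Sum>i. ennreal (1 / real T) * indicator (A i) (?x t))"
      by (rule suminf_sum) auto
    also have "\<dots> = (\<Sum>t<T. ennreal (1 / real T) * indicator (\<Union>i. A i) (?x t))"
      by (simp only: ennreal_suminf_cmult suminf_indicator[OF d])
    finally show "(\<Sum>i. \<Sum>t<T. ennreal (1 / real T) * indicator (A i) (?x t)) =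
        (\<Sum>t<T. ennreal (1 / real T) * indicator (\<Union>i. A i) (?x t))" .
  qed
  show "space (occupational_measure Y U f \<sigma> \<pi> y0 T \<omega>) = Y \<times> U"
    and "sets (occupational_measure Y U f \<sigma> \<pi> y0 T \<omega>) = ?B"
    by (simp_all add: occupational_measure_def space_measure_of_conv sets_measure_of_eq)
  show "emeasure (occupational_measure Y U f \<sigma> \<pi> y0 T \<omega>) Q = ?m Q" if "Q \<in> ?B"
    unfolding occupational_measure_def
    by (rule emeasure_measure_of_sigma[OF sa _ ca that]) (simp add: positive_def)
qed

text \<open>The set \<open>B\<^sub>T(y\<^sub>0)\<close>, of random measures over the sample space \<open>'w\<close>.\<close>

definition occupational_measures ::
  "'y::metric_space set \<Rightarrow> 'u::metric_space set \<Rightarrow> 's::metric_space set \<Rightarrow> ('y \<times> 'u \<times> 's \<Rightarrow> 'y)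
     \<Rightarrow> (nat \<Rightarrow> 'w \<Rightarrow> 's) \<Rightarrow> nat \<Rightarrow> 'y \<Rightarrow> ('w \<Rightarrow> ('y \<times> 'u) measure) set" where
  "occupational_measures Y U S f \<sigma> T y0 =
     {occupational_measure Y U f \<sigma> \<pi> y0 T | \<pi>. \<pi> \<in> control_plans S U}"

text \<open>The set \<open>W\<close>; \<open>\<mu>\<close> is the common law of the \<open>\<sigma>(t)\<close>.\<close>

definition stationary_measures ::
  "'y::metric_space set \<Rightarrow> 'u::metric_space set \<Rightarrow> 's measure \<Rightarrow> ('y \<times> 'u \<times> 's \<Rightarrow> 'y)
     \<Rightarrow> ('y \<times> 'u) measure set" where
  "stationary_measures Y U \<mu> f =
     {\<gamma>. prob_space \<gamma> \<and> sets \<gamma> = sets (borel_on (Y \<times> U)) \<and>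
        (\<forall>\<phi>::'y \<Rightarrow> real. continuous_on Y \<phi> \<longrightarrow>
           (\<integral>(y, u). (\<integral>s. \<phi> (f (y, u, s)) \<partial>\<mu>) - \<phi> y \<partial>\<gamma>) = 0)}"

text \<open>Here and below \<open>q\<close> is indexed from \<open>0\<close>: the function \<open>q\<^sub>j\<close> is \<open>q (j - 1)\<close>.\<close>

definition dense_Lipschitz_sequence ::
  "'x::metric_space set \<Rightarrow> (nat \<Rightarrow> 'x \<Rightarrow> real) \<Rightarrow> bool" where
  "dense_Lipschitz_sequence X q \<longleftrightarrow>
     (\<forall>j. \<exists>L. L-lipschitz_on X (q j)) \<and>
     (\<forall>j. \<forall>x\<in>X. \<bar>q j x\<bar> \<le> 1) \<and>
     (\<forall>g. continuous_on X g \<longrightarrow> (\<forall>x\<in>X. \<bar>g x\<bar> \<le> 1) \<longrightarrow>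
        (\<forall>\<epsilon>>0. \<exists>j. \<forall>x\<in>X. \<bar>q j x - g x\<bar> < \<epsilon>))"

definition rho :: "(nat \<Rightarrow> 'x \<Rightarrow> real) \<Rightarrow> 'x measure \<Rightarrow> 'x measure \<Rightarrow> real" where
  "rho q \<gamma> \<gamma>' = (\<Sum>j. (1/2) ^ Suc j * \<bar>(\<integral>x. q j x \<partial>\<gamma>) - (\<integral>x. q j x \<partial>\<gamma>')\<bar>)"

definition rho_E ::
  "'w measure \<Rightarrow> (nat \<Rightarrow> 'x \<Rightarrow> real) \<Rightarrow> 'x measure \<Rightarrow> ('w \<Rightarrow> 'x measure) set \<Rightarrow> real" where
  "rho_E M q \<gamma> \<Phi> = (INF \<gamma>'\<in>\<Phi>. \<integral>\<omega>. rho q \<gamma> (\<gamma>' \<omega>) \<partial>M)"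

text \<open>The vector function is \<open>(h 0, \<dots>, h (j - 1))\<close>, and \<open>L2_set\<close> is the Euclidean norm of
  \<open>\<real>\<^sup>j\<close>. The sums have \<open>T + 1\<close> terms but are divided by \<open>T\<close>.\<close>

definition strong_approximation ::
  "'w measure \<Rightarrow> 'y::metric_space set \<Rightarrow> 'u::metric_space set \<Rightarrow> 's::metric_space set
     \<Rightarrow> ('y \<times> 'u \<times> 's \<Rightarrow> 'y) \<Rightarrow> (nat \<Rightarrow> 'w \<Rightarrow> 's) \<Rightarrow> nat \<Rightarrow> (nat \<Rightarrow> 'y \<times> 'u \<Rightarrow> real) \<Rightarrow> bool" where
  "strong_approximation M Y U S f \<sigma> j h \<longleftrightarrow>
     (\<exists>\<nu>::real \<Rightarrow> real. (\<forall>T\<ge>0. 0 \<le> \<nu> T) \<and> antimono_on {0..} \<nu> \<and> (\<nu> \<longlongrightarrow> 0) at_top \<and>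
        (\<forall>T::nat. T \<ge> 1 \<longrightarrow> (\<forall>y'\<in>Y. \<forall>y''\<in>Y. \<forall>\<pi>'\<in>control_plans S U. \<exists>\<pi>''\<in>control_plans S U.
           (\<integral>\<omega>. L2_set (\<lambda>i. 1 / real T * (\<Sum>t=0..T. h i (trajectory f \<sigma> \<pi>' y' t \<omega>))
                        - 1 / real T * (\<Sum>t=0..T. h i (trajectory f \<sigma> \<pi>'' y'' t \<omega>))) {..<j} \<partial>M)
             \<le> \<nu> (real T))))"

end

theory Submission
  imports Defs
begin

text \<open>For \<open>\<gamma>\<close> in \<open>W\<close> and \<open>v = \<integral>h d\<gamma>\<close>, dynamic programming shows that every linear functional
  \<open>c\<close> of the expected \<open>n\<close>-step cost vector can be driven arbitrarily close to or below \<open>n c(v)\<close>: the value function satisfies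
  \<open>V (n + 1) y \<le> c(h(y, u)) + E V n (f (y, u, \<sigma>))\<close>, and integrating against \<open>\<gamma>\<close> cancels the last term
  against \<open>V n\<close>. As in Blackwell's approachability theorem, a plan is built from blocks of length \<open>n\<close>:
  if \<open>D\<close> is the deviation of the accumulated cost from \<open>v\<close>, the next block has a plan chosen for
  \<open>c = E D\<close>. The approximation condition makes the expected cost of that block
  nearly independent of the state in which it starts, and hence of the past, so
  the cross term in \<open>E |D|\<^sup>2\<close> is nearly \<open>c\<close> applied to a constant vector. Thus \<open>E |D|\<^sup>2\<close> grows linearly up to
  a small multiple of the square of the time, with constants that depend neither on \<open>\<gamma>\<close> nor on
  the initial state. Measurability is kept by using, from the current state, the plan made for a nearby
  point of a finite net of \<open>Y\<close>.\<close>

section \<open>Measurability on compact metric spaces\<close>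

text \<open>Without a countable base the Borel sets of a product can exceed the product
  sigma-algebra, and the types here carry only a metric. Compactness replaces the base:
  \<open>A\<close> and \<open>B\<close> have finite nets at every scale \<open>1 / Suc n\<close>, so
  the part of an open set inside \<open>A \<times> B\<close> is covered by countably many net
  rectangles contained in that open set.\<close>

lemma measurable_borel_on_Pair:
  fixes A :: "'a::metric_space set" and B :: "'b::metric_space set"
  assumes A: "compact A" and B: "compact B"
    and a: "a \<in> measurable N (borel_on A)" and b: "b \<in> measurable N (borel_on B)"
  shows "(\<lambda>x. (a x, b x)) \<in> measurable N (borel_on (A \<times> B))"
  unfolding borel_on_def
proof (rule measurable_restrict_space2)
  have aA: "a x \<in> A" and bB: "b x \<in> B" if "x \<in> space N" for x
    using measurable_space[OF a that] measurable_space[OF b that] by auto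
  then show "(\<lambda>x. (a x, b x)) \<in> space N \<rightarrow> A \<times> B"
    by auto
  have "\<exists>k. \<forall>n. finite (k n) \<and> A \<subseteq> (\<Union>x\<in>k n. ball x (1 / real (Suc n)))"
    using A unfolding compact_eq_totally_bounded by (intro choice) auto
  then obtain kA where kA: "\<And>n. finite (kA n)" "\<And>n. A \<subseteq> (\<Union>x\<in>kA n. ball x (1 / real (Suc n)))"
    by auto
  have "\<exists>k. \<forall>n. finite (k n) \<and> B \<subseteq> (\<Union>x\<in>k n. ball x (1 / real (Suc n)))"
    using B unfolding compact_eq_totally_bounded by (intro choice) auto
  then obtain kB where kB: "\<And>n. finite (kB n)" "\<And>n. B \<subseteq> (\<Union>x\<in>kB n. ball x (1 / real (Suc n)))"
    by auto
  have a': "a \<in> measurable N borel" and b': "b \<in> measurable N borel"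
    using a b by (simp_all add: borel_on_def measurable_restrict_space2_iff)
  show "(\<lambda>x. (a x, b x)) \<in> measurable N borel"
  proof (rule borel_measurableI)
    fix V :: "('a \<times> 'b) set" assume V: "open V"
    \<comment> \<open>\<open>G\<close> indexes the net rectangles lying inside \<open>V\<close>, and
      \<open>R\<close> gives their preimages, so the preimage of \<open>V\<close> becomes a
      countable union of measurable sets.\<close>
    define G where "G = {(n, x, y). x \<in> kA n \<and> y \<in> kB n \<and>
      ball x (1 / real (Suc n)) \<times> ball y (1 / real (Suc n)) \<subseteq> V}"
    define R where "R = (\<lambda>(n, x, y). (a -` ball x (1 / real (Suc n)) \<inter> space N) \<inter>
      (b -` ball y (1 / real (Suc n)) \<inter> space N))"
    have "G \<subseteq> (SIGMA n : UNIV. kA n \<times> kB n)"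
      by (auto simp: G_def)
    moreover have "countable (SIGMA n : UNIV. kA n \<times> kB n)"
      by (intro countable_SIGMA countableI_type countable_finite finite_cartesian_product kA kB)
    ultimately have G: "countable G"
      by (rule countable_subset)
    have R: "R g \<in> sets N" for g
      using a' b' by (auto simp: R_def split: prod.split intro!: sets.Int measurable_sets)
    have "(\<lambda>x. (a x, b x)) -` V \<inter> space N \<subseteq> (\<Union>g\<in>G. R g)"
    proof
      fix w assume w: "w \<in> (\<lambda>x. (a x, b x)) -` V \<inter> space N"
      then obtain e where e: "e > 0" "ball (a w, b w) e \<subseteq> V"
        using V unfolding open_contains_ball by fastforce
      \<comment> \<open>Radius below \<open>e / 4\<close> keeps each coordinate of the rectangle
        within \<open>e / 2\<close> of the given point, and the product distance is at most the sum
        of the two.\<close>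
      obtain n where n: "1 / real (Suc n) < e / 4"
        using nat_approx_posE[of "e / 4"] e by auto
      obtain x where x: "x \<in> kA n" "a w \<in> ball x (1 / real (Suc n))"
        using kA(2)[of n] aA[of w] w by auto
      obtain y where y: "y \<in> kB n" "b w \<in> ball y (1 / real (Suc n))"
        using kB(2)[of n] bB[of w] w by auto
      have "ball x (1 / real (Suc n)) \<times> ball y (1 / real (Suc n)) \<subseteq> ball (a w, b w) e"
      proof clarify
        fix x' y' assume x': "x' \<in> ball x (1 / real (Suc n))" and y': "y' \<in> ball y (1 / real (Suc n))"
        have "dist (a w) x' < e / 2"
          using x x' n dist_triangle[of "a w" x' x] by (simp add: dist_commute)
        moreover have "dist (b w) y' < e / 2"
          using y y' n dist_triangle[of "b w" y' y] by (simp add: dist_commute)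
        ultimately have "dist (a w) x' + dist (b w) y' < e"
          by simp
        then show "(x', y') \<in> ball (a w, b w) e"
          using sqrt_sum_squares_le_sum[of "dist (a w) x'" "dist (b w) y'"]
          by (simp add: dist_Pair_Pair)
      qed
      then have "(n, x, y) \<in> G"
        using x y e by (auto simp: G_def)
      moreover have "w \<in> R (n, x, y)"
        using x y w by (auto simp: R_def)
      ultimately show "w \<in> (\<Union>g\<in>G. R g)"
        by blast
    qed
    moreover have "(\<Union>g\<in>G. R g) \<subseteq> (\<lambda>x. (a x, b x)) -` V \<inter> space N"
      by (fastforce simp: G_def R_def)
    ultimately have "(\<lambda>x. (a x, b x)) -` V \<inter> space N = (\<Union>g\<in>G. R g)"
      by (rule antisym)
    also have "\<dots> \<in> sets N"
      using G R by (intro sets.countable_UN') auto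
    finally show "(\<lambda>x. (a x, b x)) -` V \<inter> space N \<in> sets N" .
  qed
qed

lemma measurable_borel_on_continuous:
  assumes "continuous_on A g" and "a \<in> measurable N (borel_on A)"
  shows "(\<lambda>x. g (a x)) \<in> measurable N borel"
  using borel_measurable_continuous_on_restrict[OF assms(1)]
  unfolding borel_on_def[symmetric] by (rule measurable_compose[OF assms(2)])

text \<open>This discretises the state measurably. Since \<open>c\<close> has values in a countable
  type, plans chosen arbitrarily for the individual net points can later be combined into a
  measurable plan.\<close>

lemma compact_countable_partition:
  fixes Y :: "'y::metric_space set"
  assumes "compact Y" "Y \<noteq> {}" "\<delta> > 0"
  obtains c :: "'y \<Rightarrow> nat" and z :: "nat \<Rightarrow> 'y"
  where "c \<in> measurable (borel_on Y) (count_space UNIV)" "\<And>n. z n \<in> Y"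
    "\<And>y. y \<in> Y \<Longrightarrow> dist y (z (c y)) < \<delta>"
proof -
  obtain D where D: "D \<subseteq> Y" "finite D" "Y \<subseteq> (\<Union>x\<in>D. ball x \<delta>)"
  proof (rule compactE_image[OF assms(1), of Y "\<lambda>x. ball x \<delta>"])
    show "Y \<subseteq> (\<Union>x\<in>Y. ball x \<delta>)"
      using assms(3) by (meson UN_I centre_in_ball subsetI)
  qed auto
  have "D \<noteq> {}"
    using D assms(2) by auto
  \<comment> \<open>The finite net is enumerated by \<open>nat\<close> with repetitions, so that
    \<open>c\<close> can be the least index of a net point within \<delta>.\<close>
  then obtain z :: "nat \<Rightarrow> 'y" where z: "range z = D"
    using range_from_nat_into[OF _ countable_finite[OF D(2)]] by blast
  define c where "c = (\<lambda>y. LEAST n. dist y (z n) < \<delta>)"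
  show thesis
  proof
    have "(\<lambda>y. dist y (z n)) \<in> borel_measurable (borel_on Y)" for n
      unfolding borel_on_def
      by (intro borel_measurable_continuous_on_restrict continuous_intros)
    then have "Measurable.pred (borel_on Y) (\<lambda>y. dist y (z n) < \<delta>)" for n
      by (intro borel_measurable_pred_less) auto
    then show "c \<in> measurable (borel_on Y) (count_space UNIV)"
      unfolding c_def by (rule measurable_Least)
    show "z n \<in> Y" for n
      using z D by auto
    show "dist y (z (c y)) < \<delta>" if y: "y \<in> Y" for y
    proof -
      obtain x where "x \<in> D" "dist y x < \<delta>"
        using y D(3) by (auto simp: dist_commute)
      then obtain n where "dist y (z n) < \<delta>"
        using z by auto
      then show ?thesis
        unfolding c_def by (rule LeastI)
    qed
  qed
qed

section \<open>Trajectories as functions of the noise sequence\<close>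

lemma control_cong:
  "(\<And>i. i < t \<Longrightarrow> \<sigma> i \<omega> = \<sigma>' i \<omega>') \<Longrightarrow> control \<sigma> \<pi> t \<omega> = control \<sigma>' \<pi> t \<omega>'"
  unfolding control_def by (rule arg_cong[where f="\<pi> t"]) (auto simp: restrict_def)

lemma state_cong:
  "(\<And>i. i < t \<Longrightarrow> \<sigma> i \<omega> = \<sigma>' i \<omega>') \<Longrightarrow> state f \<sigma> \<pi> y t \<omega> = state f \<sigma>' \<pi> y t \<omega>'"
proof (induction t)
  case (Suc t)
  have "control \<sigma> \<pi> t \<omega> = control \<sigma>' \<pi> t \<omega>'"
    using Suc.prems by (intro control_cong) auto
  with Suc show ?case by simp
qed simp

abbreviation (input) coord :: "nat \<Rightarrow> (nat \<Rightarrow> 's) \<Rightarrow> 's" where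
  "coord \<equiv> \<lambda>i s. s i"

text \<open>States and controls depend on the sample point only through the noise path, so estimates
  can be made for the coordinate process and transferred to the given probability space at the
  end.\<close>

lemma trajectory_coord: "trajectory f \<sigma> \<pi> y t \<omega> = trajectory f coord \<pi> y t (\<lambda>i. \<sigma> i \<omega>)"
proof -
  have "state f \<sigma> \<pi> y t \<omega> = state f coord \<pi> y t (\<lambda>i. \<sigma> i \<omega>)"
    by (rule state_cong) simp
  moreover have "control \<sigma> \<pi> t \<omega> = control coord \<pi> t (\<lambda>i. \<sigma> i \<omega>)"
    by (rule control_cong) simp
  ultimately show ?thesis by (simp add: trajectory_def)
qed

text \<open>Trajectories on the space of noise sequences, where the noise is the coordinate process.\<close>

locale control_system =
  fixes Y :: "'y::metric_space set" and U :: "'u::metric_space set" and S :: "'s::metric_space set"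
    and f :: "'y \<times> 'u \<times> 's \<Rightarrow> 'y" and \<mu> :: "'s measure"
  assumes compact_Y: "compact Y" and compact_U: "compact U" and compact_S: "compact S"
    and nonempty: "Y \<noteq> {}" "U \<noteq> {}"
    and continuous_f: "continuous_on (Y \<times> U \<times> S) f"
    and f_closed: "\<And>y u s. y \<in> Y \<Longrightarrow> u \<in> U \<Longrightarrow> s \<in> S \<Longrightarrow> f (y, u, s) \<in> Y"
    and prob_\<mu>: "prob_space \<mu>" and sets_\<mu>: "sets \<mu> = sets (borel_on S)"
begin

sublocale noise: prob_space \<mu>
  by (rule prob_\<mu>)

sublocale seq: sequence_space \<mu>
  by unfold_locales

abbreviation P :: "(nat \<Rightarrow> 's) measure" where
  "P \<equiv> \<Pi>\<^sub>M i\<in>UNIV. \<mu>"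

abbreviation plans :: "(nat \<Rightarrow> (nat \<Rightarrow> 's) \<Rightarrow> 'u) set" where
  "plans \<equiv> control_plans S U"

abbreviation traj :: "(nat \<Rightarrow> (nat \<Rightarrow> 's) \<Rightarrow> 'u) \<Rightarrow> 'y \<Rightarrow> nat \<Rightarrow> (nat \<Rightarrow> 's) \<Rightarrow> 'y \<times> 'u" where
  "traj \<equiv> trajectory f coord"

text \<open>Left unnormalised so that the costs of consecutive blocks add up.\<close>

definition cost ::
  "('y \<times> 'u \<Rightarrow> real) \<Rightarrow> nat \<Rightarrow> (nat \<Rightarrow> (nat \<Rightarrow> 's) \<Rightarrow> 'u) \<Rightarrow> 'y \<Rightarrow> (nat \<Rightarrow> 's) \<Rightarrow> real" where
  "cost h T \<pi> y s = (\<Sum>t<T. h (traj \<pi> y t s))"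

definition ecost :: "('y \<times> 'u \<Rightarrow> real) \<Rightarrow> nat \<Rightarrow> (nat \<Rightarrow> (nat \<Rightarrow> 's) \<Rightarrow> 'u) \<Rightarrow> 'y \<Rightarrow> real" where
  "ecost h T \<pi> y = (\<integral>s. cost h T \<pi> y s \<partial>P)"

lemma space_\<mu> [simp]: "space \<mu> = S"
  using sets_eq_imp_space_eq[OF sets_\<mu>] by simp

lemma space_P: "s \<in> space P \<longleftrightarrow> (\<forall>i. s i \<in> S)"
  by (auto simp: space_PiM PiE_UNIV_domain)

lemma measurable_\<mu>: "measurable \<mu> N = measurable (borel_on S) N"
  by (rule measurable_cong_sets) (simp_all add: sets_\<mu>)

lemma measurable_into_\<mu>: "measurable N \<mu> = measurable N (borel_on S)"
  by (rule measurable_cong_sets) (simp_all add: sets_\<mu>)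

lemma measurable_PiM_\<mu>: "measurable (PiM I (\<lambda>_. borel_on S)) N = measurable (PiM I (\<lambda>_. \<mu>)) N"
  by (rule measurable_cong_sets) (auto intro!: sets_PiM_cong simp: sets_\<mu>)

lemma plans_iff: "\<pi> \<in> plans \<longleftrightarrow> (\<forall>t. \<pi> t \<in> measurable (PiM {..<t} (\<lambda>_. \<mu>)) (borel_on U))"
  by (simp add: control_plans_def measurable_PiM_\<mu>)

lemma control_measurable:
  assumes "\<pi> \<in> plans" "{..<t} \<subseteq> I"
  shows "control coord \<pi> t \<in> measurable (PiM I (\<lambda>_. \<mu>)) (borel_on U)"
  unfolding control_def
  using assms by (intro measurable_compose[OF measurable_restrict_subset]) (auto simp: plans_iff)

lemma f_measurable:
  assumes "a \<in> measurable N (borel_on Y)" "b \<in> measurable N (borel_on U)" "c \<in> measurable N (borel_on S)"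
  shows "(\<lambda>x. f (a x, b x, c x)) \<in> measurable N (borel_on Y)"
proof -
  have m: "(\<lambda>x. (a x, b x, c x)) \<in> measurable N (borel_on (Y \<times> U \<times> S))"
    by (intro measurable_borel_on_Pair compact_Times compact_Y compact_U compact_S assms)
  have "(\<lambda>x. f (a x, b x, c x)) \<in> space N \<rightarrow> Y"
    using measurable_space[OF m] f_closed by auto
  then show ?thesis
    using measurable_borel_on_continuous[OF continuous_f m]
    by (simp add: borel_on_def[of Y] measurable_restrict_space2)
qed

lemma state_measurable:
  assumes "\<pi> \<in> plans" "y \<in> Y" "{..<t} \<subseteq> I"
  shows "state f coord \<pi> y t \<in> measurable (PiM I (\<lambda>_. \<mu>)) (borel_on Y)"
  using assms(3)
proof (induction t)
  case 0
  show ?case using assms(2) by (simp add: measurable_const)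
next
  case (Suc t)
  then have "{..<t} \<subseteq> I" "t \<in> I" by auto
  then show ?case
    using Suc.IH control_measurable[OF assms(1)] measurable_component_singleton[of t I "\<lambda>_. \<mu>"]
    by (simp add: f_measurable measurable_into_\<mu>)
qed

lemma traj_measurable:
  assumes "\<pi> \<in> plans" "y \<in> Y"
  shows "traj \<pi> y t \<in> measurable P (borel_on (Y \<times> U))"
  unfolding trajectory_def using assms
  by (intro measurable_borel_on_Pair compact_Y compact_U state_measurable control_measurable) auto

lemma traj_in:
  assumes "\<pi> \<in> plans" "y \<in> Y" "s \<in> space P"
  shows "traj \<pi> y t s \<in> Y \<times> U"
  using measurable_space[OF traj_measurable[OF assms(1,2)] assms(3)] by simp

lemma state_in:
  assumes "\<pi> \<in> plans" "y \<in> Y" "s \<in> space P"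
  shows "state f coord \<pi> y t s \<in> Y"
  using traj_in[OF assms] by (auto simp: trajectory_def)

lemma cost_measurable:
  assumes "continuous_on (Y \<times> U) h" "\<pi> \<in> plans" "y \<in> Y"
  shows "cost h T \<pi> y \<in> borel_measurable P"
  unfolding cost_def
  by (intro borel_measurable_sum measurable_borel_on_continuous[OF assms(1)] traj_measurable assms)

lemma cost_bound:
  assumes "\<And>x. x \<in> Y \<times> U \<Longrightarrow> \<bar>h x\<bar> \<le> R" "\<pi> \<in> plans" "y \<in> Y" "s \<in> space P"
  shows "\<bar>cost h T \<pi> y s\<bar> \<le> real T * R"
proof -
  have "\<bar>cost h T \<pi> y s\<bar> \<le> (\<Sum>t<T. \<bar>h (traj \<pi> y t s)\<bar>)"
    unfolding cost_def by (rule sum_abs)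
  also have "\<dots> \<le> (\<Sum>t<T. R)"
    by (intro sum_mono assms traj_in)
  finally show ?thesis by simp
qed

lemma continuous_bounded:
  assumes "continuous_on (Y \<times> U) h"
  obtains R :: real where "R \<ge> 0" "\<And>x. x \<in> Y \<times> U \<Longrightarrow> \<bar>h x\<bar> \<le> R"
proof -
  have "bounded (h ` (Y \<times> U))"
    by (intro compact_imp_bounded compact_continuous_image assms compact_Times compact_Y compact_U)
  then obtain R where "\<And>x. x \<in> Y \<times> U \<Longrightarrow> \<bar>h x\<bar> \<le> R"
    unfolding bounded_iff by auto
  then show thesis
    using that[of "max R 0"] by (meson max.cobounded1 max.cobounded2 order_trans)
qed

lemma P_integrable:
  assumes "F \<in> borel_measurable P" "\<And>s. s \<in> space P \<Longrightarrow> \<bar>F s\<bar> \<le> (B::real)"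
  shows "integrable P F"
  using assms by (intro seq.P.integrable_const_bound[where B=B]) auto

lemma cost_integrable:
  assumes "continuous_on (Y \<times> U) h" "\<pi> \<in> plans" "y \<in> Y"
  shows "integrable P (cost h T \<pi> y)"
  by (metis P_integrable cost_measurable cost_bound continuous_bounded assms)

section \<open>Equicontinuity in the initial state\<close>

text \<open>A plan sees the noise but not the state. Two trajectories under one plan and one noise
  path therefore receive the same controls, and uniform continuity of \<open>f\<close> propagates
  their closeness. This makes \<delta> independent of the plan and the noise.\<close>

lemma state_equicontinuous:
  assumes "\<epsilon> > 0"
  shows "\<exists>\<delta>>0. \<forall>\<pi>\<in>plans. \<forall>y\<in>Y. \<forall>y'\<in>Y. dist y y' < \<delta> \<longrightarrow>
    (\<forall>s\<in>space P. dist (state f coord \<pi> y t s) (state f coord \<pi> y' t s) < \<epsilon>)"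
  using assms
proof (induction t arbitrary: \<epsilon>)
  case 0
  then show ?case by auto
next
  case (Suc t)
  have "uniformly_continuous_on (Y \<times> U \<times> S) f"
    by (intro compact_uniformly_continuous continuous_f compact_Times compact_Y compact_U compact_S)
  then obtain d where d: "d > 0" "\<And>x x'. x \<in> Y \<times> U \<times> S \<Longrightarrow> x' \<in> Y \<times> U \<times> S \<Longrightarrow> dist x x' < d \<Longrightarrow> dist (f x) (f x') < \<epsilon>"
    unfolding uniformly_continuous_on_def using Suc.prems by (metis dist_commute)
  obtain \<delta> where \<delta>: "\<delta> > 0" "\<And>\<pi> y y' s. \<pi> \<in> plans \<Longrightarrow> y \<in> Y \<Longrightarrow> y' \<in> Y \<Longrightarrow> dist y y' < \<delta> \<Longrightarrow> s \<in> space P \<Longrightarrow>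
      dist (state f coord \<pi> y t s) (state f coord \<pi> y' t s) < d"
    using Suc.IH[OF d(1)] by blast
  show ?case
  proof (intro exI[of _ \<delta>] conjI ballI impI \<delta>(1))
    fix \<pi> y y' s assume *: "\<pi> \<in> plans" "y \<in> Y" "y' \<in> Y" "dist y y' < \<delta>" "s \<in> space P"
    have "control coord \<pi> t s \<in> U" "s t \<in> S"
      using traj_in[OF *(1,2,5), of t] *(5) by (auto simp: trajectory_def space_P)
    then show "dist (state f coord \<pi> y (Suc t) s) (state f coord \<pi> y' (Suc t) s) < \<epsilon>"
      using \<delta>(2)[OF *] state_in[OF *(1,2,5)] state_in[OF *(1,3,5)]
      by (auto intro!: d(2) simp: dist_Pair_Pair)
  qed
qed

lemma traj_equicontinuous:
  assumes "continuous_on (Y \<times> U) h" "\<epsilon> > (0::real)"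
  shows "\<exists>\<delta>>0. \<forall>\<pi>\<in>plans. \<forall>y\<in>Y. \<forall>y'\<in>Y. dist y y' < \<delta> \<longrightarrow>
    (\<forall>s\<in>space P. \<bar>h (traj \<pi> y t s) - h (traj \<pi> y' t s)\<bar> < \<epsilon>)"
proof -
  have "uniformly_continuous_on (Y \<times> U) h"
    by (intro compact_uniformly_continuous assms compact_Times compact_Y compact_U)
  then obtain d where d: "d > 0" "\<And>x x'. x \<in> Y \<times> U \<Longrightarrow> x' \<in> Y \<times> U \<Longrightarrow> dist x x' < d \<Longrightarrow> \<bar>h x - h x'\<bar> < \<epsilon>"
    unfolding uniformly_continuous_on_def using assms(2) by (metis dist_commute dist_real_def)
  obtain \<delta> where \<delta>: "\<delta> > 0" "\<And>\<pi> y y' s. \<pi> \<in> plans \<Longrightarrow> y \<in> Y \<Longrightarrow> y' \<in> Y \<Longrightarrow> dist y y' < \<delta> \<Longrightarrow> s \<in> space P \<Longrightarrow>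
      dist (state f coord \<pi> y t s) (state f coord \<pi> y' t s) < d"
    using state_equicontinuous[OF d(1)] by blast
  show ?thesis
  proof (intro exI[of _ \<delta>] conjI ballI impI \<delta>(1))
    fix \<pi> y y' s assume *: "\<pi> \<in> plans" "y \<in> Y" "y' \<in> Y" "dist y y' < \<delta>" "s \<in> space P"
    show "\<bar>h (traj \<pi> y t s) - h (traj \<pi> y' t s)\<bar> < \<epsilon>"
      using \<delta>(2)[OF *] traj_in[OF *(1,2,5)] traj_in[OF *(1,3,5)]
      by (intro d(2)) (auto simp: dist_Pair_Pair trajectory_def)
  qed
qed

lemma cost_equicontinuous:
  assumes h: "continuous_on (Y \<times> U) h" and "\<epsilon> > (0::real)"
  shows "\<exists>\<delta>>0. \<forall>\<pi>\<in>plans. \<forall>y\<in>Y. \<forall>y'\<in>Y. dist y y' < \<delta> \<longrightarrow>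
    (\<forall>s\<in>space P. \<bar>cost h T \<pi> y s - cost h T \<pi> y' s\<bar> < \<epsilon>)"
  using assms(2)
proof (induction T arbitrary: \<epsilon>)
  case 0
  then show ?case by (auto simp: cost_def intro: exI[of _ 1])
next
  case (Suc T)
  then have "\<epsilon> / 2 > 0" by simp
  obtain d1 where d1: "d1 > 0" "\<And>\<pi> y y' s. \<pi> \<in> plans \<Longrightarrow> y \<in> Y \<Longrightarrow> y' \<in> Y \<Longrightarrow> dist y y' < d1 \<Longrightarrow> s \<in> space P \<Longrightarrow>
      \<bar>cost h T \<pi> y s - cost h T \<pi> y' s\<bar> < \<epsilon> / 2"
    using Suc.IH[OF \<open>\<epsilon> / 2 > 0\<close>] by blast
  obtain d2 where d2: "d2 > 0" "\<And>\<pi> y y' s. \<pi> \<in> plans \<Longrightarrow> y \<in> Y \<Longrightarrow> y' \<in> Y \<Longrightarrow> dist y y' < d2 \<Longrightarrow> s \<in> space P \<Longrightarrow>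
      \<bar>h (traj \<pi> y T s) - h (traj \<pi> y' T s)\<bar> < \<epsilon> / 2"
    using traj_equicontinuous[OF h \<open>\<epsilon> / 2 > 0\<close>] by blast
  show ?case
  proof (intro exI[of _ "min d1 d2"] conjI ballI impI)
    fix \<pi> y y' s assume *: "\<pi> \<in> plans" "y \<in> Y" "y' \<in> Y" "dist y y' < min d1 d2" "s \<in> space P"
    show "\<bar>cost h (Suc T) \<pi> y s - cost h (Suc T) \<pi> y' s\<bar> < \<epsilon>"
      using d1(2)[OF *(1-3) _ *(5)] d2(2)[OF *(1-3) _ *(5)] *(4)
      unfolding cost_def sum.lessThan_Suc by linarith
  qed (use d1 d2 in auto)
qed

lemma ecost_equicontinuous:
  assumes h: "continuous_on (Y \<times> U) h" and "\<epsilon> > (0::real)"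
  obtains \<delta> where "\<delta> > 0" "\<And>\<pi> y y'. \<pi> \<in> plans \<Longrightarrow> y \<in> Y \<Longrightarrow> y' \<in> Y \<Longrightarrow> dist y y' < \<delta> \<Longrightarrow>
    \<bar>ecost h T \<pi> y - ecost h T \<pi> y'\<bar> \<le> \<epsilon>"
proof -
  obtain d where d: "d > 0" "\<And>\<pi> y y' s. \<pi> \<in> plans \<Longrightarrow> y \<in> Y \<Longrightarrow> y' \<in> Y \<Longrightarrow> dist y y' < d \<Longrightarrow> s \<in> space P \<Longrightarrow>
      \<bar>cost h T \<pi> y s - cost h T \<pi> y' s\<bar> < \<epsilon>"
    using cost_equicontinuous[OF assms] by blast
  show thesis
  proof (rule that[OF d(1)])
    fix \<pi> y y' assume *: "\<pi> \<in> plans" "y \<in> Y" "y' \<in> Y" "dist y y' < d"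
    have "\<bar>ecost h T \<pi> y - ecost h T \<pi> y'\<bar> = \<bar>\<integral>s. cost h T \<pi> y s - cost h T \<pi> y' s \<partial>P\<bar>"
      unfolding ecost_def using * h by (simp add: cost_integrable)
    also have "\<dots> \<le> (\<integral>s. \<bar>cost h T \<pi> y s - cost h T \<pi> y' s\<bar> \<partial>P)"
      by (rule integral_abs_bound)
    also have "\<dots> \<le> (\<integral>s. \<epsilon> \<partial>P)"
      using d(2)[OF *] assms(2) by (intro integral_mono') (auto intro: less_imp_le)
    finally show "\<bar>ecost h T \<pi> y - ecost h T \<pi> y'\<bar> \<le> \<epsilon>"
      by (simp add: seq.P.prob_space)
  qed
qed


section \<open>Splitting the noise and switching plans\<close>

text \<open>\<open>comb_seq k a b\<close> takes its first \<open>k\<close> entries from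
  \<open>a\<close> and continues with \<open>b\<close>, and it carries
  \<open>P \<Otimes>\<^sub>M P\<close> to \<open>P\<close>. Fubini then separates the past noise
  from the independent future noise.\<close>

lemma P_integral_comb_seq:
  fixes F :: "(nat \<Rightarrow> 's) \<Rightarrow> real"
  assumes F: "F \<in> borel_measurable P" and B: "\<And>s. s \<in> space P \<Longrightarrow> \<bar>F s\<bar> \<le> B"
  shows "integrable P (\<lambda>a. \<integral>b. F (comb_seq k a b) \<partial>P)"
    and "(\<integral>s. F s \<partial>P) = (\<integral>a. (\<integral>b. F (comb_seq k a b) \<partial>P) \<partial>P)"
proof -
  interpret pair_prob_space P P ..
  let ?G = "\<lambda>x. F ((\<lambda>(a, b). comb_seq k a b) x)"
  have G: "integrable (P \<Otimes>\<^sub>M P) ?G"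
    by (rule integrable_distr[OF measurable_comb_seq])
      (use P_integrable[OF F B] in \<open>simp add: seq.PiM_comb_seq\<close>)
  show "integrable P (\<lambda>a. \<integral>b. F (comb_seq k a b) \<partial>P)"
    using integrable_fst'[OF G] by simp
  have "(\<integral>s. F s \<partial>P) = (\<integral>s. F s \<partial>distr (P \<Otimes>\<^sub>M P) P (\<lambda>(a, b). comb_seq k a b))"
    by (simp only: seq.PiM_comb_seq)
  also have "\<dots> = (\<integral>x. ?G x \<partial>(P \<Otimes>\<^sub>M P))"
    by (rule integral_distr[OF measurable_comb_seq F])
  also have "\<dots> = (\<integral>a. (\<integral>b. ?G (a, b) \<partial>P) \<partial>P)"
    by (rule integral_fst'[OF G, symmetric])
  finally show "(\<integral>s. F s \<partial>P) = (\<integral>a. (\<integral>b. F (comb_seq k a b) \<partial>P) \<partial>P)"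
    by simp
qed

text \<open>A plan has access to the noise only, so the state at time \<open>k\<close> is recomputed
  from the first \<open>k\<close> noise values. The continuation receives the later noise shifted
  back to time 0, as an extensional function on its own index set.\<close>

definition switch ::
  "nat \<Rightarrow> (nat \<Rightarrow> (nat \<Rightarrow> 's) \<Rightarrow> 'u) \<Rightarrow> 'y \<Rightarrow> ('y \<Rightarrow> nat \<Rightarrow> (nat \<Rightarrow> 's) \<Rightarrow> 'u)
    \<Rightarrow> nat \<Rightarrow> (nat \<Rightarrow> 's) \<Rightarrow> 'u" where
  "switch k \<pi> y p t r =
    (if t < k then \<pi> t r else p (state f coord \<pi> y k r) (t - k) (\<lambda>i\<in>{..<t - k}. r (k + i)))"

text \<open>The continuation is selected through the countable-valued \<open>c\<close>, so it is
  enough to check measurability for each fixed index.\<close>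

lemma switch_plan:
  assumes \<pi>: "\<pi> \<in> plans" and y: "y \<in> Y"
    and c: "c \<in> measurable (borel_on Y) (count_space UNIV)" and p: "\<And>n::nat. p n \<in> plans"
  shows "switch k \<pi> y (\<lambda>x. p (c x)) \<in> plans"
  unfolding plans_iff
proof
  fix t
  show "switch k \<pi> y (\<lambda>x. p (c x)) t \<in> measurable (PiM {..<t} (\<lambda>_. \<mu>)) (borel_on U)"
  proof (cases "t < k")
    case True
    then have "switch k \<pi> y (\<lambda>x. p (c x)) t = \<pi> t"
      by (auto simp: switch_def)
    then show ?thesis using \<pi> by (simp add: plans_iff)
  next
    case False
    let ?N = "PiM {..<t} (\<lambda>_. \<mu>)"
    have s: "(\<lambda>r. c (state f coord \<pi> y k r)) \<in> measurable ?N (count_space UNIV)"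
      using False by (intro measurable_compose[OF state_measurable c] \<pi> y) auto
    have r: "(\<lambda>r. \<lambda>i\<in>{..<t - k}. r (k + i)) \<in> measurable ?N (PiM {..<t - k} (\<lambda>_. \<mu>))"
      using False by (intro measurable_restrict measurable_component_singleton) auto
    have "(\<lambda>r. p n (t - k) (\<lambda>i\<in>{..<t - k}. r (k + i))) \<in> measurable ?N (borel_on U)" for n
      using p[of n] by (intro measurable_compose[OF r]) (simp add: plans_iff)
    then have "(\<lambda>r. p (c (state f coord \<pi> y k r)) (t - k) (\<lambda>i\<in>{..<t - k}. r (k + i))) \<in> measurable ?N (borel_on U)"
      by (rule measurable_compose_countable[OF _ s])
    moreover have "switch k \<pi> y (\<lambda>x. p (c x)) t =
        (\<lambda>r. p (c (state f coord \<pi> y k r)) (t - k) (\<lambda>i\<in>{..<t - k}. r (k + i)))"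
      using False by (auto simp: switch_def)
    ultimately show ?thesis by simp
  qed
qed

lemma control_switch_less:
  assumes "t < k"
  shows "control coord (switch k \<pi> y p) t (comb_seq k a b) = control coord \<pi> t a"
proof -
  have "(\<lambda>i\<in>{..<t}. comb_seq k a b i) = (\<lambda>i\<in>{..<t}. a i)"
    using assms by (auto simp: comb_seq_def restrict_def)
  then show ?thesis using assms by (simp add: control_def switch_def)
qed

lemma control_switch_add:
  "control coord (switch k \<pi> y p) (k + t) (comb_seq k a b) = control coord (p (state f coord \<pi> y k a)) t b"
proof -
  have "state f coord \<pi> y k (\<lambda>i\<in>{..<k + t}. comb_seq k a b i) = state f coord \<pi> y k a"
    by (rule state_cong) (simp add: comb_seq_def)
  moreover have "(\<lambda>i\<in>{..<t}. (\<lambda>i\<in>{..<k + t}. comb_seq k a b i) (k + i)) = (\<lambda>i\<in>{..<t}. b i)"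
    by (auto simp: comb_seq_def restrict_def)
  ultimately show ?thesis by (simp add: control_def switch_def cong: restrict_cong)
qed

lemma state_switch_le:
  "t \<le> k \<Longrightarrow> state f coord (switch k \<pi> y p) y t (comb_seq k a b) = state f coord \<pi> y t a"
  by (induction t) (auto simp: control_switch_less comb_seq_less)

lemma state_switch_add:
  "state f coord (switch k \<pi> y p) y (k + t) (comb_seq k a b) =
    state f coord (p (state f coord \<pi> y k a)) (state f coord \<pi> y k a) t b"
proof (induction t)
  case 0
  show ?case by (simp add: state_switch_le)
next
  case (Suc t)
  moreover have "comb_seq k a b (k + t) = b t"
    by (simp add: comb_seq_def)
  ultimately show ?case
    by (simp add: control_switch_add)
qed

text \<open>From time \<open>k\<close> on the glued plan is a fresh run of the continuation, started
  in the state reached by \<open>a\<close> and driven by \<open>b\<close> alone.\<close>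

lemma cost_switch:
  "cost h (k + T) (switch k \<pi> y p) y (comb_seq k a b) =
    cost h k \<pi> y a + cost h T (p (state f coord \<pi> y k a)) (state f coord \<pi> y k a) b"
proof -
  have "cost h (k + T) (switch k \<pi> y p) y (comb_seq k a b) =
      (\<Sum>t<k. h (traj (switch k \<pi> y p) y t (comb_seq k a b))) +
      (\<Sum>t<T. h (traj (switch k \<pi> y p) y (k + t) (comb_seq k a b)))"
    unfolding cost_def by (induction T) (auto simp: algebra_simps)
  also have "(\<Sum>t<k. h (traj (switch k \<pi> y p) y t (comb_seq k a b))) = cost h k \<pi> y a"
    unfolding cost_def
    by (intro sum.cong) (auto simp: trajectory_def control_switch_less state_switch_le)
  also have "(\<Sum>t<T. h (traj (switch k \<pi> y p) y (k + t) (comb_seq k a b))) =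
      cost h T (p (state f coord \<pi> y k a)) (state f coord \<pi> y k a) b"
    unfolding cost_def trajectory_def control_switch_add state_switch_add ..
  finally show ?thesis .
qed

text \<open>In state \<open>x\<close> the plan made for the nearby net point \<open>c x\<close> is
  used, which keeps measurability although \<open>p\<close> is an arbitrary choice function. The
  same \<pi>' serves all cost functions and horizons at once, as the vector-valued argument
  requires.\<close>

lemma exists_switch:
  assumes \<pi>: "\<pi> \<in> plans" and y: "y \<in> Y" and p: "\<And>z. z \<in> Y \<Longrightarrow> p z \<in> plans" and "\<delta> > 0"
  obtains \<pi>' c where "\<pi>' \<in> plans" "\<And>x. x \<in> Y \<Longrightarrow> c x \<in> Y" "\<And>x. x \<in> Y \<Longrightarrow> dist x (c x) < \<delta>"
    "\<And>h T a b. cost h (k + T) \<pi>' y (comb_seq k a b) =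
      cost h k \<pi> y a + cost h T (p (c (state f coord \<pi> y k a))) (state f coord \<pi> y k a) b"
proof -
  obtain c z where c: "c \<in> measurable (borel_on Y) (count_space UNIV)" "\<And>n::nat. z n \<in> Y"
      "\<And>y. y \<in> Y \<Longrightarrow> dist y (z (c y)) < \<delta>"
    using compact_countable_partition[OF compact_Y nonempty(1) \<open>\<delta> > 0\<close>] by blast
  show thesis
    using c by (intro that[of "switch k \<pi> y (\<lambda>x. p (z (c x)))" "\<lambda>x. z (c x)"]
      switch_plan[OF \<pi> y, where p="\<lambda>n. p (z n)"] cost_switch p) auto
qed

section \<open>The value function and dynamic programming\<close>

text \<open>The value function of the control problem with horizon \<open>T\<close>. Since the
  infimum over plans may fail to be attained, plans below are optimal only up to a positive
  error.\<close>

definition opt :: "('y \<times> 'u \<Rightarrow> real) \<Rightarrow> nat \<Rightarrow> 'y \<Rightarrow> real" where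
  "opt h T y = (INF \<pi>\<in>plans. ecost h T \<pi> y)"

lemma const_plan: "u \<in> U \<Longrightarrow> (\<lambda>t r. u) \<in> plans"
  by (simp add: plans_iff measurable_const)

lemma ecost_bound:
  assumes "continuous_on (Y \<times> U) h" "\<And>x. x \<in> Y \<times> U \<Longrightarrow> \<bar>h x\<bar> \<le> R" "\<pi> \<in> plans" "y \<in> Y"
  shows "\<bar>ecost h T \<pi> y\<bar> \<le> real T * R"
proof -
  have "\<bar>ecost h T \<pi> y\<bar> \<le> (\<integral>s. \<bar>cost h T \<pi> y s\<bar> \<partial>P)"
    unfolding ecost_def by (rule integral_abs_bound)
  also have "\<dots> \<le> (\<integral>s. real T * R \<partial>P)"
    using cost_bound[OF assms(2-)] order_trans[OF abs_ge_zero cost_bound[OF assms(2-)]]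
    by (intro integral_mono') auto
  finally show ?thesis by (simp add: seq.P.prob_space)
qed

lemma bdd_below_ecost:
  assumes "continuous_on (Y \<times> U) h" "y \<in> Y"
  shows "bdd_below ((\<lambda>\<pi>. ecost h T \<pi> y) ` plans)"
proof -
  obtain R where R: "R \<ge> 0" "\<And>x. x \<in> Y \<times> U \<Longrightarrow> \<bar>h x\<bar> \<le> R"
    using continuous_bounded[OF assms(1)] by blast
  show ?thesis
    using ecost_bound[OF assms(1) R(2) _ assms(2)]
    by (intro bdd_belowI2[where m="- (real T * R)"]) (meson abs_le_D2 minus_le_iff)
qed

lemma opt_le:
  assumes "continuous_on (Y \<times> U) h" "y \<in> Y" "\<pi> \<in> plans"
  shows "opt h T y \<le> ecost h T \<pi> y"
  unfolding opt_def by (rule cINF_lower[OF bdd_below_ecost[OF assms(1,2)] assms(3)])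

lemma near_optimal_plan:
  assumes "continuous_on (Y \<times> U) h" "y \<in> Y" "\<epsilon> > 0"
  obtains \<pi> where "\<pi> \<in> plans" "ecost h T \<pi> y < opt h T y + \<epsilon>"
proof -
  have "plans \<noteq> {}"
    using const_plan nonempty by blast
  moreover have "(INF \<pi>\<in>plans. ecost h T \<pi> y) < opt h T y + \<epsilon>"
    using assms(3) by (simp add: opt_def)
  ultimately show thesis
    using that cINF_less_iff[OF _ bdd_below_ecost[OF assms(1,2)]] by blast
qed

text \<open>A near-optimal plan for one initial state is nearly as good from a neighbouring one,
  because the expected costs are equicontinuous uniformly over plans.\<close>

lemma opt_equicontinuous:
  assumes h: "continuous_on (Y \<times> U) h" and "\<epsilon> > 0"
  obtains \<delta> where "\<delta> > 0" "\<And>y y'. y \<in> Y \<Longrightarrow> y' \<in> Y \<Longrightarrow> dist y y' < \<delta> \<Longrightarrow> \<bar>opt h T y - opt h T y'\<bar> \<le> \<epsilon>"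
proof -
  have "\<epsilon> / 2 > 0" using \<open>\<epsilon> > 0\<close> by simp
  obtain \<delta> where \<delta>: "\<delta> > 0" "\<And>\<pi> y y'. \<pi> \<in> plans \<Longrightarrow> y \<in> Y \<Longrightarrow> y' \<in> Y \<Longrightarrow> dist y y' < \<delta> \<Longrightarrow>
      \<bar>ecost h T \<pi> y - ecost h T \<pi> y'\<bar> \<le> \<epsilon> / 2"
    using ecost_equicontinuous[OF h \<open>\<epsilon> / 2 > 0\<close>] by blast
  have *: "opt h T y \<le> opt h T y' + \<epsilon>" if y: "y \<in> Y" "y' \<in> Y" "dist y y' < \<delta>" for y y'
  proof -
    obtain \<pi> where \<pi>: "\<pi> \<in> plans" "ecost h T \<pi> y' < opt h T y' + \<epsilon> / 2"
      using near_optimal_plan[OF h y(2) \<open>\<epsilon> / 2 > 0\<close>] .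
    show ?thesis
      using opt_le[OF h y(1) \<pi>(1), of T] \<delta>(2)[OF \<pi>(1) y] \<pi>(2) by linarith
  qed
  show thesis
  proof (rule that[OF \<delta>(1)])
    fix y y' assume "y \<in> Y" "y' \<in> Y" "dist y y' < \<delta>"
    then show "\<bar>opt h T y - opt h T y'\<bar> \<le> \<epsilon>"
      using *[of y y'] *[of y' y] by (simp add: dist_commute abs_le_iff)
  qed
qed

lemma opt_continuous:
  assumes h: "continuous_on (Y \<times> U) h"
  shows "continuous_on Y (opt h T)"
  unfolding continuous_on_iff
proof (intro ballI allI impI)
  fix y and e :: real assume *: "y \<in> Y" "0 < e"
  then have "e / 2 > 0" by simp
  obtain \<delta> where \<delta>: "\<delta> > 0" "\<And>y y'. y \<in> Y \<Longrightarrow> y' \<in> Y \<Longrightarrow> dist y y' < \<delta> \<Longrightarrow> \<bar>opt h T y - opt h T y'\<bar> \<le> e / 2"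
    using opt_equicontinuous[OF h \<open>e / 2 > 0\<close>] by blast
  show "\<exists>d>0. \<forall>x'\<in>Y. dist x' y < d \<longrightarrow> dist (opt h T x') (opt h T y) < e"
  proof (intro exI[of _ \<delta>] conjI ballI impI \<delta>(1))
    fix x' assume "x' \<in> Y" "dist x' y < \<delta>"
    then show "dist (opt h T x') (opt h T y) < e"
      using \<delta>(2)[of x' y] * by (simp add: dist_real_def)
  qed
qed

text \<open>\<open>\<lambda>_. undefined\<close> is the only extensional function on the empty index
  set, that is, the single point at which \<open>\<pi> 0\<close> is evaluated.\<close>

lemma cost_one: "cost h (Suc 0) \<pi> y s = h (y, \<pi> 0 (\<lambda>_. undefined))"
  by (simp add: cost_def trajectory_def control_def restrict_def)

lemma P_integral_component:
  fixes g :: "'s \<Rightarrow> real"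
  assumes "g \<in> borel_measurable \<mu>"
  shows "(\<integral>s. g (s i) \<partial>P) = (\<integral>x. g x \<partial>\<mu>)"
proof -
  have "(\<integral>x. g x \<partial>\<mu>) = (\<integral>x. g x \<partial>distr P \<mu> (\<lambda>s. s i))"
    by (simp add: seq.PiM_component)
  also have "\<dots> = (\<integral>s. g (s i) \<partial>P)"
    using measurable_component_singleton[of i UNIV "\<lambda>_. \<mu>"] assms by (subst integral_distr) auto
  finally show ?thesis ..
qed

text \<open>One half of the Bellman equation: apply \<open>u\<close> once, then continue with a
  near-optimal plan for a net point close to the state that has been reached.\<close>

lemma opt_Suc_le:
  assumes h: "continuous_on (Y \<times> U) h" and y: "y \<in> Y" and u: "u \<in> U"
  shows "opt h (Suc T) y \<le> h (y, u) + (\<integral>s. opt h T (f (y, u, s)) \<partial>\<mu>)"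
proof (rule field_le_epsilon)
  fix e :: real assume "e > 0"
  \<comment> \<open>Three errors add up to \<open>e\<close>: moving \<open>opt\<close> to the net
    point, moving \<open>ecost\<close> back from it, and the near-optimality of the plan chosen
    there.\<close>
  define \<epsilon> where "\<epsilon> = e / 3"
  have \<epsilon>: "\<epsilon> > 0" using \<open>e > 0\<close> by (simp add: \<epsilon>_def)
  obtain R where R: "R \<ge> 0" "\<And>x. x \<in> Y \<times> U \<Longrightarrow> \<bar>h x\<bar> \<le> R"
    using continuous_bounded[OF h] by blast
  obtain d1 where d1: "d1 > 0" "\<And>y y'. y \<in> Y \<Longrightarrow> y' \<in> Y \<Longrightarrow> dist y y' < d1 \<Longrightarrow> \<bar>opt h T y - opt h T y'\<bar> \<le> \<epsilon>"
    using opt_equicontinuous[OF h \<epsilon>] by blast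
  obtain d2 where d2: "d2 > 0" "\<And>\<pi> y y'. \<pi> \<in> plans \<Longrightarrow> y \<in> Y \<Longrightarrow> y' \<in> Y \<Longrightarrow> dist y y' < d2 \<Longrightarrow>
      \<bar>ecost h T \<pi> y - ecost h T \<pi> y'\<bar> \<le> \<epsilon>"
    using ecost_equicontinuous[OF h \<epsilon>] by blast
  have "\<forall>z\<in>Y. \<exists>\<pi>. \<pi> \<in> plans \<and> ecost h T \<pi> z < opt h T z + \<epsilon>"
    using near_optimal_plan[OF h _ \<epsilon>] by metis
  then obtain p where p: "\<And>z. z \<in> Y \<Longrightarrow> p z \<in> plans" "\<And>z. z \<in> Y \<Longrightarrow> ecost h T (p z) z < opt h T z + \<epsilon>"
    by metis
  let ?\<pi> = "\<lambda>(t::nat) (r::nat \<Rightarrow> 's). u"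
  let ?x = "\<lambda>a. f (y, u, a 0)"
  have st: "state f coord ?\<pi> y 1 a = ?x a" for a
    by (simp add: control_def)
  obtain \<pi>' c where \<pi>': "\<pi>' \<in> plans" and c: "\<And>x. x \<in> Y \<Longrightarrow> c x \<in> Y" "\<And>x. x \<in> Y \<Longrightarrow> dist x (c x) < d1 \<and> dist x (c x) < d2"
    and cost': "\<And>h T a b. cost h (1 + T) \<pi>' y (comb_seq 1 a b) =
      cost h 1 ?\<pi> y a + cost h T (p (c (state f coord ?\<pi> y 1 a))) (state f coord ?\<pi> y 1 a) b"
    using exists_switch[where p=p and k=1 and \<delta>="min d1 d2", OF const_plan[OF u] y p(1)] d1(1) d2(1)
    unfolding min_less_iff_conj by blast
  have cost'': "cost h (Suc T) \<pi>' y (comb_seq 1 a b) = h (y, u) + cost h T (p (c (?x a))) (?x a) b" for a b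
    using cost'[of h T a b] unfolding st by (simp add: cost_one)
  have x: "?x a \<in> Y" if "a \<in> space P" for a
    using that f_closed y u by (simp add: space_P)
  have "ecost h T (p (c x)) x \<le> opt h T x + e" if "x \<in> Y" for x
    using d1(2)[OF that c(1)[OF that] c(2)[OF that, THEN conjunct1]]
      d2(2)[OF p(1)[OF c(1)[OF that]] that c(1)[OF that] c(2)[OF that, THEN conjunct2]]
      p(2)[OF c(1)[OF that]] unfolding \<epsilon>_def by linarith
  then have le: "(\<integral>b. cost h (Suc T) \<pi>' y (comb_seq 1 a b) \<partial>P) \<le> h (y, u) + (opt h T (?x a) + e)" if "a \<in> space P" for a
    using x[OF that] c(1) p(1) cost_integrable[OF h, of "p (c (?x a))" "?x a" T]
    unfolding cost'' by (simp add: ecost_def seq.P.prob_space)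
  have meas: "(\<lambda>s. opt h T (f (y, u, s))) \<in> borel_measurable \<mu>"
    unfolding measurable_\<mu>
    by (intro measurable_borel_on_continuous[OF opt_continuous[OF h]] f_measurable)
      (auto simp: y u measurable_const measurable_ident)
  have "bounded (opt h T ` Y)"
    by (intro compact_imp_bounded compact_continuous_image opt_continuous h compact_Y)
  then obtain B where B: "\<And>x. x \<in> Y \<Longrightarrow> \<bar>opt h T x\<bar> \<le> B"
    unfolding bounded_iff by auto
  have int: "integrable P (\<lambda>a. opt h T (?x a))"
    using x B measurable_compose[OF measurable_component_singleton[of 0 UNIV "\<lambda>_. \<mu>"] meas]
    by (intro P_integrable[where B=B]) auto
  have "opt h (Suc T) y \<le> ecost h (Suc T) \<pi>' y"
    by (rule opt_le[OF h y \<pi>'])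
  also have "\<dots> = (\<integral>a. (\<integral>b. cost h (Suc T) \<pi>' y (comb_seq 1 a b) \<partial>P) \<partial>P)"
    unfolding ecost_def
    by (rule P_integral_comb_seq(2)[OF cost_measurable[OF h \<pi>' y] cost_bound[OF R(2) \<pi>' y]])
  also have "\<dots> \<le> (\<integral>a. h (y, u) + (opt h T (?x a) + e) \<partial>P)"
    using int le
    by (intro integral_mono P_integral_comb_seq(1)[OF cost_measurable[OF h \<pi>' y] cost_bound[OF R(2) \<pi>' y]]) auto
  also have "\<dots> = h (y, u) + (\<integral>a. opt h T (?x a) \<partial>P) + e"
    using int by (simp add: seq.P.prob_space)
  also have "(\<integral>a. opt h T (?x a) \<partial>P) = (\<integral>s. opt h T (f (y, u, s)) \<partial>\<mu>)"
    by (rule P_integral_component[OF meas])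
  finally show "opt h (Suc T) y \<le> h (y, u) + (\<integral>s. opt h T (f (y, u, s)) \<partial>\<mu>) + e" .
qed


section \<open>Costs under stationary measures\<close>

lemma next_integrable:
  assumes \<phi>: "continuous_on Y \<phi>" and "y \<in> Y" "u \<in> U"
  shows "integrable \<mu> (\<lambda>s. \<phi> (f (y, u, s)) :: real)"
proof -
  have "bounded (\<phi> ` Y)"
    by (intro compact_imp_bounded compact_continuous_image \<phi> compact_Y)
  then obtain B where B: "\<And>x. x \<in> Y \<Longrightarrow> \<bar>\<phi> x\<bar> \<le> B"
    unfolding bounded_iff by auto
  have "(\<lambda>s. \<phi> (f (y, u, s))) \<in> borel_measurable \<mu>"
    unfolding measurable_\<mu>
    by (intro measurable_borel_on_continuous[OF \<phi>] f_measurable)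
      (auto simp: assms measurable_const measurable_ident)
  then show ?thesis
    using B f_closed assms by (intro noise.integrable_const_bound[where B=B]) auto
qed

text \<open>The Feller property of the controlled transition. It makes the expected next value
  integrable against a stationary measure, so that the integral in the stationarity identity can be
  split.\<close>

lemma next_expectation_continuous:
  assumes \<phi>: "continuous_on Y \<phi>"
  shows "continuous_on (Y \<times> U) (\<lambda>(y, u). \<integral>s. \<phi> (f (y, u, s)) \<partial>\<mu> :: real)"
  unfolding continuous_on_iff
proof (intro ballI allI impI)
  fix x and e :: real assume x: "x \<in> Y \<times> U" and e: "0 < e"
  have "f ` (Y \<times> U \<times> S) \<subseteq> Y"
    using f_closed by auto
  then have "continuous_on (Y \<times> U \<times> S) (\<lambda>z. \<phi> (f z))"
    by (rule continuous_on_compose2[OF \<phi> continuous_f])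
  then have "uniformly_continuous_on (Y \<times> U \<times> S) (\<lambda>z. \<phi> (f z))"
    by (intro compact_uniformly_continuous compact_Times compact_Y compact_U compact_S)
  then obtain d where d: "d > 0" "\<And>z z'. z \<in> Y \<times> U \<times> S \<Longrightarrow> z' \<in> Y \<times> U \<times> S \<Longrightarrow> dist z z' < d \<Longrightarrow>
      \<bar>\<phi> (f z) - \<phi> (f z')\<bar> < e / 2"
    unfolding uniformly_continuous_on_def using e by (metis dist_commute dist_real_def half_gt_zero)
  show "\<exists>d>0. \<forall>x'\<in>Y \<times> U. dist x' x < d \<longrightarrow>
      dist (case x' of (y, u) \<Rightarrow> \<integral>s. \<phi> (f (y, u, s)) \<partial>\<mu>) (case x of (y, u) \<Rightarrow> \<integral>s. \<phi> (f (y, u, s)) \<partial>\<mu>) < e"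
  proof (intro exI[of _ d] conjI ballI impI d(1))
    fix x' assume x': "x' \<in> Y \<times> U" and dist: "dist x' x < d"
    obtain y u y' u' where xs: "x = (y, u)" "x' = (y', u')" by (metis surj_pair)
    have yu: "y \<in> Y" "u \<in> U" "y' \<in> Y" "u' \<in> U" using x x' xs by auto
    have "\<bar>(\<integral>s. \<phi> (f (y', u', s)) \<partial>\<mu>) - (\<integral>s. \<phi> (f (y, u, s)) \<partial>\<mu>)\<bar> =
        \<bar>\<integral>s. \<phi> (f (y', u', s)) - \<phi> (f (y, u, s)) \<partial>\<mu>\<bar>"
      using next_integrable[OF \<phi>] yu by simp
    also have "\<dots> \<le> (\<integral>s. \<bar>\<phi> (f (y', u', s)) - \<phi> (f (y, u, s))\<bar> \<partial>\<mu>)"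
      by (rule integral_abs_bound)
    also have "\<dots> \<le> (\<integral>s. e / 2 \<partial>\<mu>)"
    proof (intro integral_mono')
      fix s assume "s \<in> space \<mu>"
      then show "\<bar>\<phi> (f (y', u', s)) - \<phi> (f (y, u, s))\<bar> \<le> e / 2"
        using yu dist xs d(2)[of "(y', u', s)" "(y, u, s)"] by (simp add: dist_Pair_Pair)
    qed (use e in auto)
    finally show "dist (case x' of (y, u) \<Rightarrow> \<integral>s. \<phi> (f (y, u, s)) \<partial>\<mu>)
        (case x of (y, u) \<Rightarrow> \<integral>s. \<phi> (f (y, u, s)) \<partial>\<mu>) < e"
      using e xs noise.prob_space by (simp add: dist_real_def)
  qed
qed

lemma continuous_integrable:
  assumes "prob_space \<gamma>" "sets \<gamma> = sets (borel_on (Y \<times> U))" and g: "continuous_on (Y \<times> U) g"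
  shows "integrable \<gamma> (g :: _ \<Rightarrow> real)"
proof -
  interpret prob_space \<gamma> by fact
  obtain R where "\<And>x. x \<in> Y \<times> U \<Longrightarrow> \<bar>g x\<bar> \<le> R"
    using continuous_bounded[OF g] by blast
  moreover have "space \<gamma> = Y \<times> U"
    using sets_eq_imp_space_eq[OF assms(2)] by simp
  moreover have "g \<in> borel_measurable \<gamma>"
    using borel_measurable_continuous_on_restrict[OF g] measurable_cong_sets[OF assms(2), of "borel :: real measure" borel]
    by (simp add: borel_on_def)
  ultimately show ?thesis
    by (intro integrable_const_bound[where B=R]) auto
qed

text \<open>Integrate the Bellman inequality against \<gamma> and use \<open>opt h T\<close>, which
  is continuous, as the test function in the definition of \<open>W\<close>. The expected next value
  then integrates to the same number as \<open>opt h T\<close>, and each step adds one integral of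
  \<open>h\<close>.\<close>

lemma stationary_opt_le:
  assumes \<gamma>: "\<gamma> \<in> stationary_measures Y U \<mu> f" and h: "continuous_on (Y \<times> U) h"
  shows "(\<integral>x. opt h T (fst x) \<partial>\<gamma>) \<le> real T * (\<integral>x. h x \<partial>\<gamma>)"
proof (induction T)
  have prob: "prob_space \<gamma>" and sets: "sets \<gamma> = sets (borel_on (Y \<times> U))"
    using \<gamma> by (auto simp: stationary_measures_def)
  have space: "space \<gamma> = Y \<times> U"
    using sets_eq_imp_space_eq[OF sets] by simp
  note int = continuous_integrable[OF prob sets]
  have opt_fst: "integrable \<gamma> (\<lambda>x. opt h T (fst x))" for T
    by (rule int, rule continuous_on_compose2[OF opt_continuous[OF h]])
      (auto intro: continuous_intros)
  {
    case 0
    obtain u where u: "u \<in> U" using nonempty by blast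
    have "opt h 0 y \<le> 0" if "y \<in> Y" for y
      using opt_le[OF h that const_plan[OF u], of 0] by (simp add: ecost_def cost_def)
    then show ?case
      using integral_mono[OF opt_fst[of 0], of "\<lambda>_. 0"] space by auto
  next
    case (Suc T)
    let ?E = "\<lambda>(y, u). \<integral>s. opt h T (f (y, u, s)) \<partial>\<mu>"
    have E: "integrable \<gamma> ?E"
      by (rule int[OF next_expectation_continuous[OF opt_continuous[OF h]]])
    have "(\<integral>(y, u). (\<integral>s. opt h T (f (y, u, s)) \<partial>\<mu>) - opt h T y \<partial>\<gamma>) = 0"
      using \<gamma> opt_continuous[OF h] by (auto simp: stationary_measures_def)
    moreover have "(\<lambda>(y, u). (\<integral>s. opt h T (f (y, u, s)) \<partial>\<mu>) - opt h T y) = (\<lambda>x. ?E x - opt h T (fst x))"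
      by auto
    ultimately have eq: "(\<integral>x. ?E x \<partial>\<gamma>) = (\<integral>x. opt h T (fst x) \<partial>\<gamma>)"
      using E opt_fst by simp
    have "(\<integral>x. opt h (Suc T) (fst x) \<partial>\<gamma>) \<le> (\<integral>x. h x + ?E x \<partial>\<gamma>)"
      using opt_Suc_le[OF h] space
      by (intro integral_mono Bochner_Integration.integrable_add opt_fst E int[OF h]) auto
    also have "\<dots> = (\<integral>x. h x \<partial>\<gamma>) + (\<integral>x. opt h T (fst x) \<partial>\<gamma>)"
      using E int[OF h] eq by simp
    finally show ?case
      using Suc.IH by (simp add: algebra_simps)
  }
qed

text \<open>A function on \<open>Y\<close> cannot exceed its bound on average by a fixed amount
  everywhere, so some state has value below the stationary cost plus \<open>\<epsilon> / 2\<close>.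
  A near-optimal plan there spends the other half of \<epsilon>.\<close>

lemma stationary_plan:
  assumes \<gamma>: "\<gamma> \<in> stationary_measures Y U \<mu> f" and h: "continuous_on (Y \<times> U) h" and "\<epsilon> > 0"
  obtains y \<pi> where "y \<in> Y" "\<pi> \<in> plans" "ecost h T \<pi> y \<le> real T * (\<integral>x. h x \<partial>\<gamma>) + \<epsilon>"
proof -
  have sets: "sets \<gamma> = sets (borel_on (Y \<times> U))"
    using \<gamma> by (auto simp: stationary_measures_def)
  interpret \<gamma>: prob_space \<gamma>
    using \<gamma> by (auto simp: stationary_measures_def)
  have space: "space \<gamma> = Y \<times> U"
    using sets_eq_imp_space_eq[OF sets] by simp
  let ?c = "real T * (\<integral>x. h x \<partial>\<gamma>)"
  have "\<exists>y\<in>Y. opt h T y < ?c + \<epsilon> / 2"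
  proof (rule ccontr)
    assume "\<not> ?thesis"
    then have *: "?c + \<epsilon> / 2 \<le> opt h T y" if "y \<in> Y" for y
      using that by (auto simp: not_less)
    have "integrable \<gamma> (\<lambda>x. opt h T (fst x))"
      by (rule continuous_integrable[OF \<gamma>.prob_space_axioms sets],
          rule continuous_on_compose2[OF opt_continuous[OF h]]) (auto intro: continuous_intros)
    then have "(\<integral>x. ?c + \<epsilon> / 2 \<partial>\<gamma>) \<le> (\<integral>x. opt h T (fst x) \<partial>\<gamma>)"
      using * space by (intro integral_mono) auto
    then show False
      using stationary_opt_le[OF \<gamma> h, of T] \<open>\<epsilon> > 0\<close> by (simp add: \<gamma>.prob_space)
  qed
  then obtain y where y: "y \<in> Y" "opt h T y < ?c + \<epsilon> / 2" by blast
  have "\<epsilon> / 2 > 0" using \<open>\<epsilon> > 0\<close> by simp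
  obtain \<pi> where "\<pi> \<in> plans" "ecost h T \<pi> y < opt h T y + \<epsilon> / 2"
    using near_optimal_plan[OF h y(1) \<open>\<epsilon> / 2 > 0\<close>] .
  then show thesis
    using y that[of y \<pi>] by auto
qed

text \<open>Scalarisation: the previous result is applied to the cost
  \<open>\<Sum>i<J. c i * q i x\<close>. The weights may have any sign, and the fixed slack 1 is
  harmless because it is paid once per block.\<close>

lemma stationary_plan_weighted:
  assumes \<gamma>: "\<gamma> \<in> stationary_measures Y U \<mu> f" and q: "\<And>i. i < J \<Longrightarrow> continuous_on (Y \<times> U) (q i)"
  obtains y \<pi> where "y \<in> Y" "\<pi> \<in> plans"
    "(\<Sum>i<J. c i * (ecost (q i) T \<pi> y - real T * (\<integral>x. q i x \<partial>\<gamma>))) \<le> 1"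
proof -
  let ?h = "\<lambda>x. \<Sum>i<J. c i * q i x"
  have h: "continuous_on (Y \<times> U) ?h"
    by (intro continuous_intros q) auto
  have sets: "sets \<gamma> = sets (borel_on (Y \<times> U))" and prob: "prob_space \<gamma>"
    using \<gamma> by (auto simp: stationary_measures_def)
  have "(\<integral>x. ?h x \<partial>\<gamma>) = (\<Sum>i<J. c i * (\<integral>x. q i x \<partial>\<gamma>))"
    using continuous_integrable[OF prob sets q] by (subst Bochner_Integration.integral_sum) auto
  then have "real T * (\<integral>x. ?h x \<partial>\<gamma>) = (\<Sum>i<J. c i * (real T * (\<integral>x. q i x \<partial>\<gamma>)))"
    by (simp add: sum_distrib_left mult_ac)
  moreover have "ecost ?h T \<pi> y = (\<Sum>i<J. c i * ecost (q i) T \<pi> y)" if "\<pi> \<in> plans" "y \<in> Y" for \<pi> y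
  proof -
    have "cost ?h T \<pi> y = (\<lambda>s. \<Sum>i<J. c i * cost (q i) T \<pi> y s)"
      unfolding cost_def by (subst sum.swap) (simp add: sum_distrib_left)
    then show ?thesis
      using cost_integrable[OF q that] unfolding ecost_def
      by (simp add: Bochner_Integration.integral_sum)
  qed
  moreover obtain y \<pi> where "y \<in> Y" "\<pi> \<in> plans" "ecost ?h T \<pi> y \<le> real T * (\<integral>x. ?h x \<partial>\<gamma>) + 1"
    using stationary_plan[OF \<gamma> h, of 1 T] by auto
  ultimately show thesis
    by (intro that[of y \<pi>]) (auto simp: right_diff_distrib sum_subtractf)
qed


section \<open>The block construction of approachability\<close>

lemma deviation_bound:
  assumes "\<And>x. x \<in> Y \<times> U \<Longrightarrow> \<bar>h x\<bar> \<le> 1" "\<bar>v\<bar> \<le> 1" "\<pi> \<in> plans" "y \<in> Y" "s \<in> space P"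
  shows "\<bar>cost h T \<pi> y s - real T * v\<bar> \<le> 2 * real T"
proof -
  have "\<bar>real T * v\<bar> \<le> real T * 1"
    unfolding abs_mult using assms(2) by (intro mult_mono) auto
  then show ?thesis
    using cost_bound[where h=h and T=T, OF assms(1,3-5)] by linarith
qed

text \<open>The cross term factors because \<open>w\<close> does not depend on the state at time \<open>m\<close>.\<close>

lemma deviation_square_step:
  assumes h: "continuous_on (Y \<times> U) h" and h1: "\<And>x. x \<in> Y \<times> U \<Longrightarrow> \<bar>h x\<bar> \<le> 1" and v: "\<bar>v\<bar> \<le> 1"
    and \<pi>: "\<pi> \<in> plans" and \<pi>': "\<pi>' \<in> plans" and y: "y \<in> Y"
    and p: "\<And>x. x \<in> Y \<Longrightarrow> p x \<in> plans"
    and cost: "\<And>a b. cost h (m + n) \<pi>' y (comb_seq m a b) =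
      cost h m \<pi> y a + cost h n (p (state f coord \<pi> y m a)) (state f coord \<pi> y m a) b"
    and w: "\<And>x. x \<in> Y \<Longrightarrow> \<bar>ecost h n (p x) x - w\<bar> \<le> e"
  shows "(\<integral>s. (cost h (m + n) \<pi>' y s - real (m + n) * v)\<^sup>2 \<partial>P) \<le>
    (\<integral>s. (cost h m \<pi> y s - real m * v)\<^sup>2 \<partial>P) +
    2 * ((\<integral>s. cost h m \<pi> y s - real m * v \<partial>P) * (w - real n * v)) + 4 * real m * e + 4 * (real n)\<^sup>2"
proof -
  let ?D = "\<lambda>a. cost h m \<pi> y a - real m * v"
  let ?D' = "\<lambda>s. cost h (m + n) \<pi>' y s - real (m + n) * v"
  have e: "e \<ge> 0"
    using w y abs_ge_zero order_trans by blast
  have mD: "?D \<in> borel_measurable P" and mD': "?D' \<in> borel_measurable P"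
    using cost_measurable[OF h] \<pi> \<pi>' y by auto
  have bD: "\<bar>?D a\<bar> \<le> 2 * real m" if "a \<in> space P" for a
    by (rule deviation_bound[where h=h, OF h1 v \<pi> y that])
  have sq: "\<bar>x\<^sup>2\<bar> \<le> (2 * c)\<^sup>2" if "\<bar>x\<bar> \<le> 2 * c" for x c :: real
    using power_mono[OF that abs_ge_zero, where n=2] by simp
  have bD': "\<bar>(?D' s)\<^sup>2\<bar> \<le> (2 * real (m + n))\<^sup>2" if "s \<in> space P" for s
    by (intro sq deviation_bound[where h=h, OF h1 v \<pi>' y that])
  have iD: "integrable P ?D" and iD2: "integrable P (\<lambda>a. (?D a)\<^sup>2)"
    using mD bD sq[OF bD] by (auto intro!: P_integrable)
  \<comment> \<open>For a fixed past \<open>a\<close>, the square of the deviation after the second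
    block is expanded and averaged over \<open>b\<close>. Replacing the conditional mean cost by
    \<open>w\<close> costs \<open>2 * (2 * m) * e\<close>, and the squared block deviation is at
    most \<open>(2 * n)\<^sup>2\<close>.\<close>
  have inner: "(\<integral>b. (?D' (comb_seq m a b))\<^sup>2 \<partial>P) \<le>
      (?D a)\<^sup>2 + 2 * (?D a * (w - real n * v)) + (4 * real m * e + 4 * (real n)\<^sup>2)" if a: "a \<in> space P" for a
  proof -
    define x where "x = state f coord \<pi> y m a"
    have x: "x \<in> Y" unfolding x_def by (rule state_in[OF \<pi> y a])
    let ?B = "\<lambda>b. cost h n (p x) x b - real n * v"
    have mB: "?B \<in> borel_measurable P"
      using cost_measurable[OF h] p x by auto
    have bB: "\<bar>?B b\<bar> \<le> 2 * real n" if "b \<in> space P" for b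
      by (rule deviation_bound[where h=h, OF h1 v p[OF x] x that])
    have iB: "integrable P ?B" and iB2: "integrable P (\<lambda>b. (?B b)\<^sup>2)"
      using mB bB sq[OF bB] by (auto intro!: P_integrable)
    have "(?D' (comb_seq m a b))\<^sup>2 = (?D a)\<^sup>2 + (2 * ?D a * ?B b + (?B b)\<^sup>2)" for b
      unfolding cost x_def[symmetric] by (simp add: power2_eq_square algebra_simps)
    then have "(\<integral>b. (?D' (comb_seq m a b))\<^sup>2 \<partial>P) = (?D a)\<^sup>2 + (2 * ?D a * (\<integral>b. ?B b \<partial>P) + (\<integral>b. (?B b)\<^sup>2 \<partial>P))"
      using iB iB2 by (simp add: seq.P.prob_space)
    also have "(\<integral>b. ?B b \<partial>P) = ecost h n (p x) x - real n * v"
      using cost_integrable[OF h p[OF x] x] by (simp add: ecost_def seq.P.prob_space)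
    finally have "(\<integral>b. (?D' (comb_seq m a b))\<^sup>2 \<partial>P) =
      (?D a)\<^sup>2 + (2 * ?D a * (ecost h n (p x) x - real n * v) + (\<integral>b. (?B b)\<^sup>2 \<partial>P))" .
    moreover have "(\<integral>b. (?B b)\<^sup>2 \<partial>P) \<le> (\<integral>b. (2 * real n)\<^sup>2 \<partial>P)"
      using sq[OF bB] by (intro integral_mono iB2) auto
    moreover have "?D a * (ecost h n (p x) x - w) \<le> (2 * real m) * e"
    proof -
      have "?D a * (ecost h n (p x) x - w) \<le> \<bar>?D a\<bar> * \<bar>ecost h n (p x) x - w\<bar>"
        by (metis abs_ge_self abs_mult)
      also have "\<dots> \<le> (2 * real m) * e"
        using bD[OF a] w[OF x] e by (intro mult_mono) auto
      finally show ?thesis .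
    qed
    moreover have "2 * ?D a * (ecost h n (p x) x - real n * v) =
        2 * (?D a * (w - real n * v)) + 2 * (?D a * (ecost h n (p x) x - w))"
      by (simp add: algebra_simps)
    moreover have "(\<integral>b. (2 * real n)\<^sup>2 \<partial>P) = 4 * (real n)\<^sup>2"
      by (simp add: seq.P.prob_space)
    ultimately show ?thesis by linarith
  qed
  have "(\<integral>s. (?D' s)\<^sup>2 \<partial>P) = (\<integral>a. (\<integral>b. (?D' (comb_seq m a b))\<^sup>2 \<partial>P) \<partial>P)"
    by (rule P_integral_comb_seq(2)[OF _ bD']) (use mD' in auto)
  also have "\<dots> \<le> (\<integral>a. (?D a)\<^sup>2 + 2 * (?D a * (w - real n * v)) + (4 * real m * e + 4 * (real n)\<^sup>2) \<partial>P)"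
  proof (rule integral_mono[OF _ _ inner])
    show "integrable P (\<lambda>a. \<integral>b. (?D' (comb_seq m a b))\<^sup>2 \<partial>P)"
      by (rule P_integral_comb_seq(1)[OF _ bD']) (use mD' in auto)
    show "integrable P (\<lambda>a. (?D a)\<^sup>2 + 2 * (?D a * (w - real n * v)) + (4 * real m * e + 4 * (real n)\<^sup>2))"
      by (intro Bochner_Integration.integrable_add iD2 integrable_mult_right integrable_mult_left iD) auto
  qed
  also have "\<dots> = (\<integral>a. (?D a)\<^sup>2 \<partial>P) + 2 * ((\<integral>a. ?D a \<partial>P) * (w - real n * v)) + (4 * real m * e + 4 * (real n)\<^sup>2)"
  proof -
    have "integrable P (\<lambda>a. 2 * (?D a * (w - real n * v)))"
      by (intro integrable_mult_right integrable_mult_left iD)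
    moreover have "(\<integral>a. 2 * (?D a * (w - real n * v)) \<partial>P) = 2 * ((\<integral>a. ?D a \<partial>P) * (w - real n * v))"
      by (subst integral_mult_right_zero, subst integral_mult_left_zero) (rule refl)
    ultimately show ?thesis
      using iD2 by (subst Bochner_Integration.integral_add, auto simp: seq.P.prob_space
        simp del: integral_mult_right_zero integral_mult_left_zero)
  qed
  finally show ?thesis by simp
qed

text \<open>Induction on the number of blocks. A further block adds at most 2 (twice the drift), 4 J
  n^2 (squared block deviations) and 4 J K n (e + 1) (dependence of the block cost on its starting
  state). Accumulated over the blocks, these give a part linear in \<open>K\<close> and a part
  quadratic in \<open>K\<close>.\<close>

lemma approachability:
  assumes q: "\<And>i. i < J \<Longrightarrow> continuous_on (Y \<times> U) (q i)"
    and q1: "\<And>i x. i < J \<Longrightarrow> x \<in> Y \<times> U \<Longrightarrow> \<bar>q i x\<bar> \<le> 1"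
    and \<gamma>: "\<gamma> \<in> stationary_measures Y U \<mu> f" and v: "\<And>i. i < J \<Longrightarrow> v i = (\<integral>x. q i x \<partial>\<gamma>)"
    and v1: "\<And>i. i < J \<Longrightarrow> \<bar>v i\<bar> \<le> 1"
    and appr: "\<And>\<pi>' y' y. \<pi>' \<in> plans \<Longrightarrow> y' \<in> Y \<Longrightarrow> y \<in> Y \<Longrightarrow>
      \<exists>\<pi>\<in>plans. \<forall>i<J. \<bar>ecost (q i) n \<pi> y - ecost (q i) n \<pi>' y'\<bar> \<le> e"
    and y: "y \<in> Y"
  shows "\<exists>\<pi>\<in>plans. (\<Sum>i<J. \<integral>s. (cost (q i) (K * n) \<pi> y s - real (K * n) * v i)\<^sup>2 \<partial>P) \<le>
    real K * (2 + 4 * real J * (real n)\<^sup>2) + (real K)\<^sup>2 * (4 * real J * real n * (e + 1))"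
proof (induction K)
  case 0
  obtain u where "u \<in> U" using nonempty by blast
  then show ?case
    by (intro bexI[OF _ const_plan]) (auto simp: cost_def)
next
  case (Suc K)
  then obtain \<pi> where \<pi>: "\<pi> \<in> plans" and IH:
    "(\<Sum>i<J. \<integral>s. (cost (q i) (K * n) \<pi> y s - real (K * n) * v i)\<^sup>2 \<partial>P) \<le>
      real K * (2 + 4 * real J * (real n)\<^sup>2) + (real K)\<^sup>2 * (4 * real J * real n * (e + 1))"
    by blast
  \<comment> \<open>The mean deviation so far is used as the weight vector, so the drift bound says
    that the next block hardly moves the mean outward.\<close>
  define c where "c i = (\<integral>s. cost (q i) (K * n) \<pi> y s - real (K * n) * v i \<partial>P)" for i
  obtain y1 \<pi>1 where y1: "y1 \<in> Y" and \<pi>1: "\<pi>1 \<in> plans"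
    and "(\<Sum>i<J. c i * (ecost (q i) n \<pi>1 y1 - real n * (\<integral>x. q i x \<partial>\<gamma>))) \<le> 1"
    using stationary_plan_weighted[where J=J and q=q and c=c and T=n, OF \<gamma> q] by blast
  then have drift: "(\<Sum>i<J. c i * (ecost (q i) n \<pi>1 y1 - real n * v i)) \<le> 1"
    using v by (simp cong: sum.cong_simp)
  \<comment> \<open>The sign enters the final estimate, where \<open>K\<^sup>2 + K\<close> is
    replaced by \<open>(K + 1)\<^sup>2\<close>. It follows from \<open>appr\<close> when there is a
    coordinate; for \<open>J = 0\<close> the whole factor vanishes.\<close>
  have e: "e + 1 \<ge> 0" if J: "J > 0"
  proof -
    obtain \<pi>2 where "\<bar>ecost (q 0) n \<pi>2 y1 - ecost (q 0) n \<pi>1 y1\<bar> \<le> e"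
      using appr[OF \<pi>1 y1 y1] J by blast
    then show ?thesis by linarith
  qed
  have "\<exists>\<delta>>0. \<forall>i<J. \<forall>\<pi>\<in>plans. \<forall>x\<in>Y. \<forall>x'\<in>Y. dist x x' < \<delta> \<longrightarrow>
      \<bar>ecost (q i) n \<pi> x - ecost (q i) n \<pi> x'\<bar> \<le> 1"
  proof -
    have "\<forall>i\<in>{..<J}. \<exists>\<delta>>0. \<forall>\<pi>\<in>plans. \<forall>x\<in>Y. \<forall>x'\<in>Y. dist x x' < \<delta> \<longrightarrow>
        \<bar>ecost (q i) n \<pi> x - ecost (q i) n \<pi> x'\<bar> \<le> 1"
      using ecost_equicontinuous[OF q, of _ 1 n] by (metis lessThan_iff zero_less_one)
    then obtain d where d: "\<And>i. i < J \<Longrightarrow> d i > 0" "\<And>i \<pi> x x'. i < J \<Longrightarrow> \<pi> \<in> plans \<Longrightarrow> x \<in> Y \<Longrightarrow> x' \<in> Y \<Longrightarrow>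
        dist x x' < d i \<Longrightarrow> \<bar>ecost (q i) n \<pi> x - ecost (q i) n \<pi> x'\<bar> \<le> 1"
      by (metis lessThan_iff)
    \<comment> \<open>A single radius for all \<open>J\<close> coordinates; inserting 1 keeps the
      set nonempty when \<open>J = 0\<close>.\<close>
    have "Min (insert 1 (d ` {..<J})) > 0" "\<And>i. i < J \<Longrightarrow> Min (insert 1 (d ` {..<J})) \<le> d i"
      using d(1) by auto
    then show ?thesis
      using d(2) by (meson less_le_trans)
  qed
  then obtain \<delta> where \<delta>: "\<delta> > 0" "\<And>i \<pi> x x'. i < J \<Longrightarrow> \<pi> \<in> plans \<Longrightarrow> x \<in> Y \<Longrightarrow> x' \<in> Y \<Longrightarrow>
        dist x x' < \<delta> \<Longrightarrow> \<bar>ecost (q i) n \<pi> x - ecost (q i) n \<pi> x'\<bar> \<le> 1"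
    by blast
  \<comment> \<open>\<open>p z\<close> imitates from \<open>z\<close> the good plan
    \<open>\<pi>1\<close> started in \<open>y1\<close>. All these plans have nearly the same
    expected block cost, which is the constant \<open>w\<close> of the square estimate. The bound
    there is \<open>e + 1\<close>, with 1 for passing from a state to its net point.\<close>
  obtain p where p: "\<And>z. z \<in> Y \<Longrightarrow> p z \<in> plans"
      "\<And>z i. z \<in> Y \<Longrightarrow> i < J \<Longrightarrow> \<bar>ecost (q i) n (p z) z - ecost (q i) n \<pi>1 y1\<bar> \<le> e"
    using appr[OF \<pi>1 y1] by metis
  obtain \<pi>' cl where \<pi>': "\<pi>' \<in> plans" and cl: "\<And>x. x \<in> Y \<Longrightarrow> cl x \<in> Y" "\<And>x. x \<in> Y \<Longrightarrow> dist x (cl x) < \<delta>"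
    and cost': "\<And>h T a b. cost h (K * n + T) \<pi>' y (comb_seq (K * n) a b) =
      cost h (K * n) \<pi> y a + cost h T (p (cl (state f coord \<pi> y (K * n) a))) (state f coord \<pi> y (K * n) a) b"
    using exists_switch[where p=p and k="K * n", OF \<pi> y p(1) \<delta>(1)] by blast
  have step: "(\<integral>s. (cost (q i) (K * n + n) \<pi>' y s - real (K * n + n) * v i)\<^sup>2 \<partial>P) \<le>
      (\<integral>s. (cost (q i) (K * n) \<pi> y s - real (K * n) * v i)\<^sup>2 \<partial>P) +
      2 * (c i * (ecost (q i) n \<pi>1 y1 - real n * v i)) + 4 * real (K * n) * (e + 1) + 4 * (real n)\<^sup>2"
    if i: "i < J" for i
    unfolding c_def
  proof (rule deviation_square_step[where p="\<lambda>x. p (cl x)", OF q[OF i] q1[OF i] v1[OF i] \<pi> \<pi>' y _ cost'])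
    show "p (cl x) \<in> plans" if "x \<in> Y" for x
      using cl p that by blast
    show "\<bar>ecost (q i) n (p (cl x)) x - ecost (q i) n \<pi>1 y1\<bar> \<le> e + 1" if "x \<in> Y" for x
      using \<delta>(2)[OF i p(1)[OF cl(1)[OF that]] that cl(1)[OF that] cl(2)[OF that]] p(2)[OF cl(1)[OF that] i]
      by linarith
  qed
  have "(\<Sum>i<J. \<integral>s. (cost (q i) (K * n + n) \<pi>' y s - real (K * n + n) * v i)\<^sup>2 \<partial>P) \<le>
      (\<Sum>i<J. (\<integral>s. (cost (q i) (K * n) \<pi> y s - real (K * n) * v i)\<^sup>2 \<partial>P) +
      2 * (c i * (ecost (q i) n \<pi>1 y1 - real n * v i)) + 4 * real (K * n) * (e + 1) + 4 * (real n)\<^sup>2)"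
    using step by (intro sum_mono) auto
  also have "\<dots> = (\<Sum>i<J. \<integral>s. (cost (q i) (K * n) \<pi> y s - real (K * n) * v i)\<^sup>2 \<partial>P) +
      2 * (\<Sum>i<J. c i * (ecost (q i) n \<pi>1 y1 - real n * v i)) +
      real J * (4 * real (K * n) * (e + 1) + 4 * (real n)\<^sup>2)"
    by (simp only: sum.distrib sum_distrib_left[symmetric] sum_constant card_lessThan)
      (simp add: algebra_simps)
  also have "\<dots> \<le> (real K * (2 + 4 * real J * (real n)\<^sup>2) + (real K)\<^sup>2 * (4 * real J * real n * (e + 1))) +
      2 * 1 + real J * (4 * real (K * n) * (e + 1) + 4 * (real n)\<^sup>2)"
    using IH drift by (intro add_mono mult_left_mono) auto
  also have "\<dots> = real (Suc K) * (2 + 4 * real J * (real n)\<^sup>2) +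
      ((real K)\<^sup>2 + real K) * (4 * real J * real n * (e + 1))"
    by (simp add: algebra_simps)
  also have "\<dots> \<le> real (Suc K) * (2 + 4 * real J * (real n)\<^sup>2) +
      (real (Suc K))\<^sup>2 * (4 * real J * real n * (e + 1))"
  proof (intro add_left_mono mult_right_mono)
    show "0 \<le> 4 * real J * real n * (e + 1)"
      using e by (cases "J = 0") (auto intro!: mult_nonneg_nonneg)
  qed (simp add: power2_eq_square algebra_simps)
  finally show ?case
    using \<pi>' by (auto simp: add.commute)
qed

lemma cost_add_bound:
  assumes "\<And>x. x \<in> Y \<times> U \<Longrightarrow> \<bar>h x\<bar> \<le> 1" "\<pi> \<in> plans" "y \<in> Y" "s \<in> space P"
  shows "\<bar>cost h (m + r) \<pi> y s - cost h m \<pi> y s\<bar> \<le> real r"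
proof (induction r)
  case (Suc r)
  then show ?case
    using assms(1)[OF traj_in[OF assms(2-4), of "m + r"]] by (auto simp: cost_def)
qed (simp add: cost_def)

text \<open>Run the construction for the \<open>T div n\<close> complete blocks and bound the fewer
  than \<open>n\<close> remaining steps trivially. The resulting bound involves neither \<gamma> nor
  \<open>y\<close>, which is the source of uniformity.\<close>

lemma stationary_average_plan:
  assumes q: "\<And>i. i < J \<Longrightarrow> continuous_on (Y \<times> U) (q i)"
    and q1: "\<And>i x. i < J \<Longrightarrow> x \<in> Y \<times> U \<Longrightarrow> \<bar>q i x\<bar> \<le> 1"
    and \<gamma>: "\<gamma> \<in> stationary_measures Y U \<mu> f" and v: "\<And>i. i < J \<Longrightarrow> v i = (\<integral>x. q i x \<partial>\<gamma>)"
    and v1: "\<And>i. i < J \<Longrightarrow> \<bar>v i\<bar> \<le> 1"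
    and appr: "\<And>\<pi>' y' y. \<pi>' \<in> plans \<Longrightarrow> y' \<in> Y \<Longrightarrow> y \<in> Y \<Longrightarrow>
      \<exists>\<pi>\<in>plans. \<forall>i<J. \<bar>ecost (q i) n \<pi> y - ecost (q i) n \<pi>' y'\<bar> \<le> e"
    and y: "y \<in> Y" and n: "n > 0" and nT: "n \<le> T" and \<eta>: "\<eta> > 0"
  shows "\<exists>\<pi>\<in>plans. \<forall>i<J. (\<integral>s. \<bar>cost (q i) T \<pi> y s / real T - v i\<bar> \<partial>P) \<le>
    \<eta> + ((2 + 4 * real J * (real n)\<^sup>2) / (real (T div n) * (real n)\<^sup>2) + 4 * real J * (e + 1) / real n) / \<eta> +
    2 * real n / real T"
proof -
  define K where "K = T div n"
  define N where "N = K * n"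
  have K: "K > 0" using n nT by (simp add: K_def div_greater_zero_iff)
  have N: "N > 0" "N \<le> T" "T - N < n"
    using K n minus_div_mult_eq_mod[of T n] mod_less_divisor[OF n, of T] by (auto simp: N_def K_def)
  define \<Phi> where "\<Phi> = real K * (2 + 4 * real J * (real n)\<^sup>2) + (real K)\<^sup>2 * (4 * real J * real n * (e + 1))"
  obtain \<pi> where \<pi>: "\<pi> \<in> plans" and sum: "(\<Sum>i<J. \<integral>s. (cost (q i) N \<pi> y s - real N * v i)\<^sup>2 \<partial>P) \<le> \<Phi>"
    using approachability[where J=J and q=q and v=v and n=n and e=e and K=K, OF q q1 \<gamma> v v1 appr y]
    unfolding N_def \<Phi>_def by blast
  \<comment> \<open>After normalisation one term decays with the number of blocks, and the other is
    governed by \<open>(e + 1) / n\<close>; they are made small by a large \<open>T\<close> and a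
    suitable \<open>n\<close> respectively.\<close>
  have \<Phi>: "\<Phi> / (real N)\<^sup>2 = (2 + 4 * real J * (real n)\<^sup>2) / (real K * (real n)\<^sup>2) + 4 * real J * (e + 1) / real n"
    using K n by (simp add: \<Phi>_def N_def field_simps power2_eq_square)
  show ?thesis
  proof (intro bexI[OF _ \<pi>] allI impI)
    fix i assume i: "i < J"
    let ?D = "\<lambda>s. cost (q i) N \<pi> y s - real N * v i"
    have mD: "?D \<in> borel_measurable P"
      using cost_measurable[OF q[OF i] \<pi> y] by auto
    have "\<bar>(?D s)\<^sup>2\<bar> \<le> (2 * real N)\<^sup>2" if "s \<in> space P" for s
      using power_mono[OF deviation_bound[where h="q i" and T=N, OF q1[OF i] v1[OF i] \<pi> y that] abs_ge_zero, where n=2] by simp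
    then have iD2: "integrable P (\<lambda>s. (?D s)\<^sup>2)"
      using mD by (auto intro!: P_integrable)
    have "(\<integral>s. (?D s)\<^sup>2 \<partial>P) \<le> (\<Sum>i<J. \<integral>s. (cost (q i) N \<pi> y s - real N * v i)\<^sup>2 \<partial>P)"
      using i by (intro member_le_sum) auto
    with sum have ED: "(\<integral>s. (?D s)\<^sup>2 \<partial>P) \<le> \<Phi>" by linarith
    have "\<bar>cost (q i) T \<pi> y s / real T - v i\<bar> \<le> \<eta> + (?D s)\<^sup>2 / ((real N)\<^sup>2 * \<eta>) + 2 * real n / real T"
      if s: "s \<in> space P" for s
    proof -
      have split: "cost (q i) T \<pi> y s - real T * v i =
          ?D s + ((cost (q i) (N + (T - N)) \<pi> y s - cost (q i) N \<pi> y s) - real (T - N) * v i)"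
        using N by (simp add: of_nat_diff algebra_simps)
      have "\<bar>real (T - N) * v i\<bar> \<le> real n * 1"
        unfolding abs_mult using v1[OF i] N by (intro mult_mono) auto
      moreover have "\<bar>cost (q i) (N + (T - N)) \<pi> y s - cost (q i) N \<pi> y s\<bar> \<le> real n"
        using cost_add_bound[where h="q i" and m=N and r="T - N", OF q1[OF i] \<pi> y s] N by linarith
      \<comment> \<open>The incomplete block contributes at most \<open>n\<close> through its costs
        and at most \<open>n\<close> through the multiples of \<open>v i\<close>.\<close>
      ultimately have le: "\<bar>cost (q i) T \<pi> y s - real T * v i\<bar> \<le> \<bar>?D s\<bar> + 2 * real n"
        unfolding split by linarith
      have "cost (q i) T \<pi> y s / real T - v i = (cost (q i) T \<pi> y s - real T * v i) / real T"
        using N by (simp add: diff_divide_distrib)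
      then have "\<bar>cost (q i) T \<pi> y s / real T - v i\<bar> = \<bar>cost (q i) T \<pi> y s - real T * v i\<bar> / real T"
        by simp
      also have "\<dots> \<le> (\<bar>?D s\<bar> + 2 * real n) / real T"
        by (intro divide_right_mono le) simp
      also have "\<dots> = \<bar>?D s\<bar> / real T + 2 * real n / real T"
        by (rule add_divide_distrib)
      also have "\<bar>?D s\<bar> / real T \<le> \<bar>?D s\<bar> / real N"
        using N by (intro divide_left_mono) auto
      \<comment> \<open>This passes from mean squares to mean absolute values: a number above \<eta>
        is at most its square divided by \<eta>.\<close>
      also have "\<bar>?D s\<bar> / real N \<le> \<eta> + (\<bar>?D s\<bar> / real N)\<^sup>2 / \<eta>"
      proof (cases "\<bar>?D s\<bar> / real N \<le> \<eta>")
        case True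
        then show ?thesis using \<eta> by (intro add_increasing2) auto
      next
        case False
        then have "\<eta> * (\<bar>?D s\<bar> / real N) \<le> (\<bar>?D s\<bar> / real N)\<^sup>2"
          unfolding power2_eq_square by (intro mult_right_mono) auto
        then have "\<bar>?D s\<bar> / real N \<le> (\<bar>?D s\<bar> / real N)\<^sup>2 / \<eta>"
          using \<eta> by (simp add: pos_le_divide_eq mult.commute)
        then show ?thesis using \<eta> by linarith
      qed
      also have "(\<bar>?D s\<bar> / real N)\<^sup>2 / \<eta> = (?D s)\<^sup>2 / ((real N)\<^sup>2 * \<eta>)"
        by (simp add: power_divide)
      finally show ?thesis by simp
    qed
    then have "(\<integral>s. \<bar>cost (q i) T \<pi> y s / real T - v i\<bar> \<partial>P) \<le>
        (\<integral>s. \<eta> + (?D s)\<^sup>2 / ((real N)\<^sup>2 * \<eta>) + 2 * real n / real T \<partial>P)"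
      using iD2 \<eta> by (intro integral_mono') auto
    also have "\<dots> = \<eta> + (\<integral>s. (?D s)\<^sup>2 \<partial>P) / ((real N)\<^sup>2 * \<eta>) + 2 * real n / real T"
      using iD2 by (simp add: seq.P.prob_space)
    also have "\<dots> \<le> \<eta> + \<Phi> / ((real N)\<^sup>2 * \<eta>) + 2 * real n / real T"
      using ED \<eta> by (intro add_mono divide_right_mono) auto
    also have "\<Phi> / ((real N)\<^sup>2 * \<eta>) = (\<Phi> / (real N)\<^sup>2) / \<eta>"
      by simp
    finally show "(\<integral>s. \<bar>cost (q i) T \<pi> y s / real T - v i\<bar> \<partial>P) \<le>
      \<eta> + ((2 + 4 * real J * (real n)\<^sup>2) / (real (T div n) * (real n)\<^sup>2) + 4 * real J * (e + 1) / real n) / \<eta> +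
      2 * real n / real T"
      unfolding \<Phi> K_def .
  qed
qed

end

section \<open>Occupational measures and the weighted series\<close>

text \<open>The occupational measure is the image of the uniform measure on \<open>{..<T}\<close>
  under the trajectory, so integrals against it are time averages.\<close>

lemma integral_occupational_measure:
  assumes g: "continuous_on (Y \<times> U) g" and T: "T > 0"
    and tr: "\<And>t. t < T \<Longrightarrow> trajectory f \<sigma> \<pi> y0 t \<omega> \<in> Y \<times> U"
  shows "(\<integral>x. g x \<partial>occupational_measure Y U f \<sigma> \<pi> y0 T \<omega>) =
    (\<Sum>t<T. g (trajectory f \<sigma> \<pi> y0 t \<omega>)) / real T"
proof -
  let ?u = "uniform_count_measure {..<T}"
  let ?x = "\<lambda>t. trajectory f \<sigma> \<pi> y0 t \<omega>"
  have x: "?x \<in> measurable ?u (borel_on (Y \<times> U))"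
    using tr by (auto simp: measurable_def space_uniform_count_measure sets_uniform_count_measure)
  have "occupational_measure Y U f \<sigma> \<pi> y0 T \<omega> = distr ?u (borel_on (Y \<times> U)) ?x"
  proof (rule measure_eqI)
    fix Q assume "Q \<in> sets (occupational_measure Y U f \<sigma> \<pi> y0 T \<omega>)"
    then have Q: "Q \<in> sets (borel_on (Y \<times> U))" by simp
    have "emeasure (distr ?u (borel_on (Y \<times> U)) ?x) Q = emeasure ?u {t \<in> {..<T}. ?x t \<in> Q}"
      by (subst emeasure_distr[OF x Q]) (auto intro!: arg_cong2[where f=emeasure] simp: space_uniform_count_measure)
    also have "\<dots> = ennreal (real (card {t \<in> {..<T}. ?x t \<in> Q}) / real T)"
      by (subst emeasure_uniform_count_measure) auto
    also have "real (card {t \<in> {..<T}. ?x t \<in> Q}) = (\<Sum>t<T. indicator Q (?x t))"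
      by (simp add: indicator_def sum.If_cases Int_def)
    finally show "emeasure (occupational_measure Y U f \<sigma> \<pi> y0 T \<omega>) Q = emeasure (distr ?u (borel_on (Y \<times> U)) ?x) Q"
      by (simp add: emeasure_occupational_measure[OF Q])
  qed simp
  moreover have "g \<in> borel_measurable (borel_on (Y \<times> U))"
    using borel_measurable_continuous_on_restrict[OF g] by (simp add: borel_on_def)
  ultimately show ?thesis
    using integral_distr[OF x, of g] by (simp add: integral_uniform_count_measure)
qed

lemma halves_sum_le: "(\<Sum>j<J. (1/2::real) ^ Suc j) \<le> 1"
proof -
  have "(\<Sum>j<J. (1/2::real) ^ Suc j) = 1 - (1/2) ^ J"
    by (induction J) (simp_all add: field_simps)
  then show ?thesis by simp
qed

lemma
  fixes a :: "nat \<Rightarrow> real"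
  assumes a: "\<And>j. 0 \<le> a j" "\<And>j. a j \<le> 2"
  shows weighted_suminf_nonneg: "0 \<le> (\<Sum>j. (1/2) ^ Suc j * a j)"
    and weighted_suminf_le: "(\<Sum>j. (1/2) ^ Suc j * a j) \<le> (\<Sum>j<J. (1/2) ^ Suc j * a j) + 2 * (1/2) ^ J"
proof -
  have le: "(1/2) ^ Suc j * a j \<le> (1/2) ^ j" for j
    using a(2)[of j] by simp
  have geo: "summable (\<lambda>j. (1/2::real) ^ j)"
    by (rule summable_geometric) simp
  have sm: "summable (\<lambda>j. (1/2) ^ Suc j * a j)"
    using le a(1) by (intro summable_comparison_test'[OF geo, of 0]) (simp add: abs_mult)
  show "0 \<le> (\<Sum>j. (1/2) ^ Suc j * a j)"
    using a(1) by (intro suminf_nonneg sm) auto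
  \<comment> \<open>The bound 2 on the terms cancels one factor of one half, and the tail of the
    geometric series from index \<open>J\<close> on sums to \<open>2 * (1/2) ^ J\<close>.\<close>
  have "(\<Sum>j. (1/2) ^ Suc (j + J) * a (j + J)) \<le> (\<Sum>j. (1/2) ^ (j + J))"
    using le by (intro suminf_le summable_ignore_initial_segment[OF sm] summable_ignore_initial_segment[OF geo]) blast
  also have "\<dots> = (\<Sum>j. (1/2) ^ J * (1/2) ^ j)"
    by (simp add: power_add mult.commute)
  also have "\<dots> = 2 * (1/2::real) ^ J"
    by (subst suminf_mult[OF geo]) (simp add: suminf_geometric)
  finally show "(\<Sum>j. (1/2) ^ Suc j * a j) \<le> (\<Sum>j<J. (1/2) ^ Suc j * a j) + 2 * (1/2) ^ J"
    by (subst suminf_split_initial_segment[OF sm, of J]) linarith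
qed

section \<open>Transfer to the given probability space\<close>

locale driven_system = control_system Y U S f \<mu> + M: prob_space M
  for Y :: "'y::metric_space set" and U :: "'u::metric_space set" and S :: "'s::metric_space set"
    and f \<mu> and M :: "'w measure" +
  fixes \<sigma> :: "nat \<Rightarrow> 'w \<Rightarrow> 's" and q :: "nat \<Rightarrow> 'y \<times> 'u \<Rightarrow> real"
  assumes indep: "M.indep_vars (\<lambda>_. borel_on S) \<sigma> UNIV"
    and law: "\<And>t. distr M (borel_on S) (\<sigma> t) = \<mu>"
    and q: "dense_Lipschitz_sequence (Y \<times> U) q"
begin

lemma q_continuous: "continuous_on (Y \<times> U) (q j)"
  using q lipschitz_on_continuous_on unfolding dense_Lipschitz_sequence_def by blast

lemma q_bound: "x \<in> Y \<times> U \<Longrightarrow> \<bar>q j x\<bar> \<le> 1"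
  using q unfolding dense_Lipschitz_sequence_def by blast

lemma \<sigma>_measurable: "\<sigma> t \<in> measurable M (borel_on S)"
  using indep unfolding M.indep_vars_def by blast

lemma \<sigma>_in_P: "\<omega> \<in> space M \<Longrightarrow> (\<lambda>i. \<sigma> i \<omega>) \<in> space P"
  using measurable_space[OF \<sigma>_measurable] by (auto simp: space_P)

lemma noise_path_measurable: "(\<lambda>\<omega> i. \<sigma> i \<omega>) \<in> measurable M (PiM UNIV (\<lambda>_. borel_on S))"
  using measurable_restrict[where I=UNIV and X=\<sigma> and M="\<lambda>_. borel_on S", OF \<sigma>_measurable]
  by (simp add: restrict_def)

text \<open>Independence and the common law \<mu> make the joint law of the noise path equal to
  \<open>P\<close>; the rest is a change of variables.\<close>

lemma M_integral:
  fixes F :: "(nat \<Rightarrow> 's) \<Rightarrow> real"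
  assumes F: "F \<in> borel_measurable P"
  shows "(\<integral>\<omega>. F (\<lambda>i. \<sigma> i \<omega>) \<partial>M) = (\<integral>s. F s \<partial>P)"
proof -
  let ?N = "PiM UNIV (\<lambda>_::nat. borel_on S)"
  have "distr M ?N (\<lambda>\<omega> i. \<sigma> i \<omega>) = P"
    using M.indep_vars_iff_distr_eq_PiM[where X=\<sigma> and I=UNIV and M'="\<lambda>_. borel_on S", OF _ \<sigma>_measurable] indep
    by (simp add: law restrict_def)
  then have "(\<integral>s. F s \<partial>P) = (\<integral>s. F s \<partial>distr M ?N (\<lambda>\<omega> i. \<sigma> i \<omega>))"
    by simp
  also have "\<dots> = (\<integral>\<omega>. F (\<lambda>i. \<sigma> i \<omega>) \<partial>M)"
  proof (rule integral_distr)
    show "(\<lambda>\<omega> i. \<sigma> i \<omega>) \<in> measurable M ?N"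
      by (rule noise_path_measurable)
    show "F \<in> borel_measurable ?N"
      using F by (simp add: measurable_PiM_\<mu>)
  qed
  finally show ?thesis ..
qed

lemma M_integrable:
  fixes F :: "(nat \<Rightarrow> 's) \<Rightarrow> real"
  assumes "F \<in> borel_measurable P" "\<And>s. s \<in> space P \<Longrightarrow> \<bar>F s\<bar> \<le> B"
  shows "integrable M (\<lambda>\<omega>. F (\<lambda>i. \<sigma> i \<omega>))"
proof -
  have "(\<lambda>\<omega>. F (\<lambda>i. \<sigma> i \<omega>)) \<in> borel_measurable M"
    by (rule measurable_compose[OF noise_path_measurable]) (use assms(1) in \<open>simp add: measurable_PiM_\<mu>\<close>)
  then show ?thesis
    using assms(2) \<sigma>_in_P by (intro M.integrable_const_bound[where B=B]) auto
qed

lemma integral_q_occupational: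
  assumes "\<pi> \<in> plans" "y \<in> Y" "\<omega> \<in> space M" "T > 0"
  shows "(\<integral>x. q j x \<partial>occupational_measure Y U f \<sigma> \<pi> y T \<omega>) = cost (q j) T \<pi> y (\<lambda>i. \<sigma> i \<omega>) / real T"
  using integral_occupational_measure[OF q_continuous assms(4), of f \<sigma> \<pi> y \<omega>]
    traj_in[OF assms(1,2) \<sigma>_in_P[OF assms(3)]] trajectory_coord[of f \<sigma> \<pi> y _ \<omega>]
  by (simp add: cost_def)

lemma average_bound:
  assumes "\<pi> \<in> plans" "y \<in> Y" "s \<in> space P" "T > 0"
  shows "\<bar>cost (q j) T \<pi> y s / real T\<bar> \<le> 1"
  using cost_bound[where h="q j" and T=T, OF q_bound assms(1-3)] assms(4) by simp

lemma integral_q_bound: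
  assumes "\<gamma> \<in> stationary_measures Y U \<mu> f"
  shows "\<bar>\<integral>x. q j x \<partial>\<gamma>\<bar> \<le> 1"
proof -
  have sets: "sets \<gamma> = sets (borel_on (Y \<times> U))"
    using assms by (auto simp: stationary_measures_def)
  interpret \<gamma>: prob_space \<gamma>
    using assms by (auto simp: stationary_measures_def)
  have "space \<gamma> = Y \<times> U"
    using sets_eq_imp_space_eq[OF sets] by simp
  then have "(\<integral>x. \<bar>q j x\<bar> \<partial>\<gamma>) \<le> (\<integral>x. 1 \<partial>\<gamma>)"
    using q_bound by (intro integral_mono') auto
  with integral_abs_bound show ?thesis
    by (rule order_trans[THEN order_trans]) (simp add: \<gamma>.prob_space)
qed

text \<open>Any single plan bounds the infimum, and cutting the series of \<open>rho\<close> at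
  \<open>J\<close> reduces the estimate to finitely many mean errors on the noise space.\<close>

lemma rho_E_le:
  assumes \<gamma>: "\<gamma> \<in> stationary_measures Y U \<mu> f" and \<pi>: "\<pi> \<in> plans" and y: "y \<in> Y" and T: "T > 0"
  shows "rho_E M q \<gamma> (occupational_measures Y U S f \<sigma> T y) \<le>
    (\<Sum>j<J. (1/2) ^ Suc j * (\<integral>s. \<bar>cost (q j) T \<pi> y s / real T - (\<integral>x. q j x \<partial>\<gamma>)\<bar> \<partial>P)) + 2 * (1/2) ^ J"
proof -
  let ?a = "\<lambda>\<pi> j s. \<bar>cost (q j) T \<pi> y s / real T - (\<integral>x. q j x \<partial>\<gamma>)\<bar>"
  let ?occ = "\<lambda>\<pi>. occupational_measure Y U f \<sigma> \<pi> y T"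
  have rho: "rho q \<gamma> (?occ \<pi> \<omega>) = (\<Sum>j. (1/2) ^ Suc j * ?a \<pi> j (\<lambda>i. \<sigma> i \<omega>))"
    if "\<pi> \<in> plans" "\<omega> \<in> space M" for \<pi> \<omega>
    using integral_q_occupational[OF that(1) y that(2) T] by (simp add: rho_def abs_minus_commute)
  have a2: "?a \<pi> j s \<le> 2" if "\<pi> \<in> plans" "s \<in> space P" for \<pi> j s
    using average_bound[OF that(1) y that(2) T, of j] integral_q_bound[OF \<gamma>, of j] by linarith
  have nonneg: "0 \<le> rho q \<gamma> (?occ \<pi> \<omega>)" if "\<pi> \<in> plans" "\<omega> \<in> space M" for \<pi> \<omega>
    unfolding rho[OF that] using a2[OF that(1) \<sigma>_in_P[OF that(2)]]
    by (intro weighted_suminf_nonneg) auto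
  \<comment> \<open>A real-valued infimum lies below its members only once a lower bound is
    known.\<close>
  have "bdd_below ((\<lambda>\<gamma>'. \<integral>\<omega>. rho q \<gamma> (\<gamma>' \<omega>) \<partial>M) ` occupational_measures Y U S f \<sigma> T y)"
    by (intro bdd_belowI2[where m=0] Bochner_Integration.integral_nonneg)
      (auto simp: occupational_measures_def intro: nonneg)
  then have "rho_E M q \<gamma> (occupational_measures Y U S f \<sigma> T y) \<le> (\<integral>\<omega>. rho q \<gamma> (?occ \<pi> \<omega>) \<partial>M)"
    unfolding rho_E_def using \<pi> by (intro cINF_lower) (auto simp: occupational_measures_def)
  also have "\<dots> \<le> (\<integral>\<omega>. (\<Sum>j<J. (1/2) ^ Suc j * ?a \<pi> j (\<lambda>i. \<sigma> i \<omega>)) + 2 * (1/2) ^ J \<partial>M)"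
  \<comment> \<open>Integrability is shown for the truncated bound alone. A nonintegrable left side
    would have Bochner integral 0, which the nonnegativity of the bound covers.\<close>
  proof (rule integral_mono')
    have "?a \<pi> j \<in> borel_measurable P" for j
      using cost_measurable[OF q_continuous \<pi> y] by auto
    then have a: "integrable M (\<lambda>\<omega>. ?a \<pi> j (\<lambda>i. \<sigma> i \<omega>))" for j
      using a2[OF \<pi>] by (intro M_integrable[where B=2]) auto
    then show "integrable M (\<lambda>\<omega>. (\<Sum>j<J. (1/2) ^ Suc j * ?a \<pi> j (\<lambda>i. \<sigma> i \<omega>)) + 2 * (1/2) ^ J)"
      by (intro Bochner_Integration.integrable_add Bochner_Integration.integrable_sum integrable_mult_right) auto
    fix \<omega> assume \<omega>: "\<omega> \<in> space M"
    show "rho q \<gamma> (?occ \<pi> \<omega>) \<le> (\<Sum>j<J. (1/2) ^ Suc j * ?a \<pi> j (\<lambda>i. \<sigma> i \<omega>)) + 2 * (1/2) ^ J"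
      unfolding rho[OF \<pi> \<omega>] using a2[OF \<pi> \<sigma>_in_P[OF \<omega>]]
      by (intro weighted_suminf_le) auto
    show "0 \<le> (\<Sum>j<J. (1/2) ^ Suc j * ?a \<pi> j (\<lambda>i. \<sigma> i \<omega>)) + 2 * (1/2) ^ J"
      by (intro add_nonneg_nonneg sum_nonneg) auto
  qed
  also have "\<dots> = (\<integral>s. (\<Sum>j<J. (1/2) ^ Suc j * ?a \<pi> j s) + 2 * (1/2) ^ J \<partial>P)"
    using cost_measurable[OF q_continuous \<pi> y]
    by (intro M_integral borel_measurable_add borel_measurable_sum borel_measurable_times borel_measurable_abs
      borel_measurable_diff borel_measurable_divide borel_measurable_const)
  also have "\<dots> = (\<Sum>j<J. (1/2) ^ Suc j * (\<integral>s. ?a \<pi> j s \<partial>P)) + 2 * (1/2) ^ J"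
  proof -
    have "integrable P (?a \<pi> j)" for j
      using a2[OF \<pi>] cost_measurable[OF q_continuous \<pi> y] by (intro P_integrable[where B=2]) auto
    then show ?thesis
      by (simp add: seq.P.prob_space)
  qed
  finally show ?thesis .
qed

text \<open>The approximation condition sums \<open>n + 1\<close> terms while a block has
  \<open>n\<close> steps; this is the price of the extra term.\<close>

lemma ecost_Suc_bound:
  assumes "\<pi> \<in> plans" "y \<in> Y"
  shows "\<bar>ecost (q i) (Suc n) \<pi> y - ecost (q i) n \<pi> y\<bar> \<le> 1"
proof -
  have "ecost (q i) (Suc n) \<pi> y - ecost (q i) n \<pi> y = (\<integral>s. cost (q i) (Suc n) \<pi> y s - cost (q i) n \<pi> y s \<partial>P)"
    unfolding ecost_def using cost_integrable[OF q_continuous assms] by simp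
  also have "\<bar>\<dots>\<bar> \<le>
      (\<integral>s. \<bar>cost (q i) (Suc n) \<pi> y s - cost (q i) n \<pi> y s\<bar> \<partial>P)"
    by (rule integral_abs_bound)
  also have "\<dots> \<le> (\<integral>s. 1 \<partial>P)"
    using cost_add_bound[where h="q i" and m=n and r=1, OF q_bound assms]
    by (intro integral_mono') auto
  finally show ?thesis by (simp add: seq.P.prob_space)
qed

text \<open>The Euclidean norm dominates every coordinate, and the absolute value of a mean is at
  most the mean absolute value. Undoing the division gives the factor \<open>n\<close>, and the
  surplus term in each of the two sums accounts for the 2.\<close>

lemma approximation_expectation:
  assumes \<pi>': "\<pi>' \<in> plans" and \<pi>: "\<pi> \<in> plans" and y': "y' \<in> Y" and y: "y \<in> Y" and n: "n > 0"
    and le: "(\<integral>\<omega>. L2_set (\<lambda>i. 1 / real n * (\<Sum>t=0..n. q i (trajectory f \<sigma> \<pi>' y' t \<omega>))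
                        - 1 / real n * (\<Sum>t=0..n. q i (trajectory f \<sigma> \<pi> y t \<omega>))) {..<J} \<partial>M) \<le> b"
    and i: "i < J"
  shows "\<bar>ecost (q i) n \<pi> y - ecost (q i) n \<pi>' y'\<bar> \<le> real n * b + 2"
proof -
  let ?F = "\<lambda>i s. (cost (q i) (Suc n) \<pi>' y' s - cost (q i) (Suc n) \<pi> y s) / real n"
  let ?G = "\<lambda>s. L2_set (\<lambda>i. ?F i s) {..<J}"
  have mF: "?F i \<in> borel_measurable P" for i
    using cost_measurable[OF q_continuous] \<pi>' \<pi> y' y by auto
  have mG: "?G \<in> borel_measurable P"
    unfolding L2_set_def using mF
    by (intro measurable_compose[OF _ borel_measurable_sqrt] borel_measurable_sum borel_measurable_power)
  have bF: "\<bar>?F i s\<bar> \<le> 2 * real (Suc n)" if s: "s \<in> space P" for i s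
  proof -
    have "\<bar>cost (q i) (Suc n) \<pi>' y' s - cost (q i) (Suc n) \<pi> y s\<bar> \<le> 2 * real (Suc n)"
      using cost_bound[where h="q i" and T="Suc n", OF q_bound \<pi>' y' s]
        cost_bound[where h="q i" and T="Suc n", OF q_bound \<pi> y s] by linarith
    then have "\<bar>?F i s\<bar> \<le> 2 * real (Suc n) / real n"
      unfolding abs_divide abs_of_nat by (intro divide_right_mono) auto
    also have "\<dots> \<le> 2 * real (Suc n) / 1"
      using n by (intro divide_left_mono) auto
    finally show ?thesis by simp
  qed
  have iF: "integrable P (?F i)"
    using mF bF by (rule P_integrable)
  have iG: "integrable P ?G"
  proof (rule P_integrable[OF mG])
    fix s assume s: "s \<in> space P"
    have "?G s \<le> (\<Sum>i<J. \<bar>?F i s\<bar>)"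
      by (rule L2_set_le_sum_abs)
    also have "\<dots> \<le> (\<Sum>i<J. 2 * real (Suc n))"
      by (intro sum_mono bF s)
    finally show "\<bar>?G s\<bar> \<le> (\<Sum>i<J. 2 * real (Suc n))"
      by (simp add: L2_set_nonneg)
  qed
  have "(\<integral>\<omega>. L2_set (\<lambda>i. 1 / real n * (\<Sum>t=0..n. q i (trajectory f \<sigma> \<pi>' y' t \<omega>))
      - 1 / real n * (\<Sum>t=0..n. q i (trajectory f \<sigma> \<pi> y t \<omega>))) {..<J} \<partial>M) = (\<integral>\<omega>. ?G (\<lambda>i. \<sigma> i \<omega>) \<partial>M)"
    unfolding cost_def trajectory_coord[of f \<sigma>] lessThan_Suc_atMost atMost_atLeast0
    by (simp add: diff_divide_distrib)
  with le M_integral[OF mG] have "(\<integral>s. ?G s \<partial>P) \<le> b"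
    by simp
  moreover have "\<bar>\<integral>s. ?F i s \<partial>P\<bar> \<le> (\<integral>s. \<bar>?F i s\<bar> \<partial>P)"
    by (rule integral_abs_bound)
  moreover have "(\<integral>s. \<bar>?F i s\<bar> \<partial>P) \<le> (\<integral>s. ?G s \<partial>P)"
  proof (intro integral_mono iG integrable_abs iF)
    fix s
    show "\<bar>?F i s\<bar> \<le> ?G s"
      using member_le_L2_set[of "{..<J}" i "\<lambda>i. \<bar>?F i s\<bar>", OF finite_lessThan] i
      by (simp only: L2_set_def power2_abs lessThan_iff)
  qed
  moreover have "(\<integral>s. ?F i s \<partial>P) = (ecost (q i) (Suc n) \<pi>' y' - ecost (q i) (Suc n) \<pi> y) / real n"
    using cost_integrable[OF q_continuous \<pi>' y'] cost_integrable[OF q_continuous \<pi> y] by (simp add: ecost_def)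
  ultimately have "\<bar>(ecost (q i) (Suc n) \<pi>' y' - ecost (q i) (Suc n) \<pi> y) / real n\<bar> \<le> b"
    by linarith
  then have "\<bar>ecost (q i) (Suc n) \<pi>' y' - ecost (q i) (Suc n) \<pi> y\<bar> \<le> real n * b"
    using n by (simp add: abs_divide pos_divide_le_eq mult.commute)
  then show ?thesis
    using ecost_Suc_bound[OF \<pi>' y', of i n] ecost_Suc_bound[OF \<pi> y, of i n] by linarith
qed

section \<open>Choice of the parameters and the uniform limit\<close>

text \<open>The parameters are chosen in the order \<open>J\<close> (tail of the series),
  \<open>n\<close> (block length, through the approximation rate for the first \<open>J\<close>
  functions) and \<open>T1\<close>. None of them depends on \<gamma> or \<open>y\<close>.\<close>

lemma rho_E_uniformly_small:
  assumes sa: "\<And>j. j \<ge> 1 \<Longrightarrow> strong_approximation M Y U S f \<sigma> j q" and \<epsilon>: "\<epsilon> > 0"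
  shows "\<exists>T1. \<forall>T\<ge>T1. \<forall>\<gamma>\<in>stationary_measures Y U \<mu> f. \<forall>y\<in>Y.
    rho_E M q \<gamma> (occupational_measures Y U S f \<sigma> T y) \<le> \<epsilon>"
proof -
  obtain J0 where J0: "(1/2::real) ^ J0 < \<epsilon> / 4"
    using real_arch_pow_inv[of "\<epsilon> / 4" "1/2"] \<epsilon> by auto
  \<comment> \<open>The successor ensures \<open>J \<ge> 1\<close>, as the approximation hypothesis
    demands.\<close>
  define J where "J = Suc J0"
  have J: "J \<ge> 1" "2 * (1/2::real) ^ J \<le> \<epsilon> / 2"
    using J0 \<epsilon> by (simp_all add: J_def)
  \<comment> \<open>Each mean error will be at most \<open>\<eta> + 2 * \<eta> + \<eta>\<close>,
    which is \<open>\<epsilon> / 2\<close>; the other half is for the tail.\<close>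
  define \<eta> where "\<eta> = \<epsilon> / 8"
  have \<eta>: "\<eta> > 0" using \<epsilon> by (simp add: \<eta>_def)
  obtain \<nu> :: "real \<Rightarrow> real" where \<nu>: "(\<nu> \<longlongrightarrow> 0) at_top"
    and appr: "\<And>n y' y \<pi>'. n \<ge> 1 \<Longrightarrow> y' \<in> Y \<Longrightarrow> y \<in> Y \<Longrightarrow> \<pi>' \<in> plans \<Longrightarrow> \<exists>\<pi>\<in>plans.
           (\<integral>\<omega>. L2_set (\<lambda>i. 1 / real n * (\<Sum>t=0..n. q i (trajectory f \<sigma> \<pi>' y' t \<omega>))
                        - 1 / real n * (\<Sum>t=0..n. q i (trajectory f \<sigma> \<pi> y t \<omega>))) {..<J} \<partial>M)
             \<le> \<nu> (real n)"
    using sa[OF J(1)] unfolding strong_approximation_def by blast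
  \<comment> \<open>This is \<open>4 * J * (e + 1) / n\<close> for the value
    \<open>e = n * \<nu> n + 2\<close> defined below.\<close>
  have "((\<lambda>n. 4 * real J * \<nu> (real n) + 12 * real J * (1 / real n)) \<longlongrightarrow> 4 * real J * 0 + 12 * real J * 0) sequentially"
    by (intro tendsto_intros filterlim_compose[OF \<nu> filterlim_real_sequentially] lim_1_over_n)
  then have "eventually (\<lambda>n. 4 * real J * \<nu> (real n) + 12 * real J * (1 / real n) < \<eta>\<^sup>2) sequentially"
    using \<eta> by (intro order_tendstoD(2)) auto
  then obtain n where n: "n > 0" and small: "4 * real J * \<nu> (real n) + 12 * real J * (1 / real n) \<le> \<eta>\<^sup>2"
    using eventually_conj[OF _ eventually_gt_at_top[of 0]]
    by (metis (mono_tags, lifting) eventually_sequentially less_imp_le order_refl)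
  define e where "e = real n * \<nu> (real n) + 2"
  have e: "4 * real J * (e + 1) / real n \<le> \<eta>\<^sup>2"
    using small n by (simp add: e_def field_simps)
  have appr': "\<exists>\<pi>\<in>plans. \<forall>i<J. \<bar>ecost (q i) n \<pi> y - ecost (q i) n \<pi>' y'\<bar> \<le> e"
    if *: "\<pi>' \<in> plans" "y' \<in> Y" "y \<in> Y" for \<pi>' y' y
  proof -
    obtain \<pi> where \<pi>: "\<pi> \<in> plans" and le:
      "(\<integral>\<omega>. L2_set (\<lambda>i. 1 / real n * (\<Sum>t=0..n. q i (trajectory f \<sigma> \<pi>' y' t \<omega>))
        - 1 / real n * (\<Sum>t=0..n. q i (trajectory f \<sigma> \<pi> y t \<omega>))) {..<J} \<partial>M) \<le> \<nu> (real n)"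
      using appr[OF _ *(2,3,1), of n] n by auto
    show ?thesis
      using approximation_expectation[OF *(1) \<pi> *(2,3) n le] \<pi> unfolding e_def by blast
  qed
  define C where "C = 2 + 4 * real J * (real n)\<^sup>2"
  have C: "C \<ge> 0" by (simp add: C_def)
  define K0 where "K0 = Suc (nat \<lceil>C / \<eta>\<^sup>2\<rceil>)"
  have K0: "K0 > 0" "C / \<eta>\<^sup>2 \<le> real K0"
    unfolding K0_def by (simp, linarith)
  \<comment> \<open>The first entry guarantees \<open>K0\<close> complete blocks, which makes the
    term with \<open>C\<close> at most \<open>\<eta>\<^sup>2\<close>; the second makes the
    incomplete block contribute at most \<eta>.\<close>
  define T1 where "T1 = max (n * K0) (nat \<lceil>2 * real n / \<eta>\<rceil>)"
  show ?thesis
  proof (intro exI[of _ T1] allI impI ballI)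
    fix T \<gamma> y assume T: "T1 \<le> T" and \<gamma>: "\<gamma> \<in> stationary_measures Y U \<mu> f" and y: "y \<in> Y"
    have TK: "n * K0 \<le> T" using T by (simp add: T1_def)
    have nT: "n \<le> T" using TK K0(1) by (cases K0) auto
    have K: "K0 \<le> T div n"
      using div_le_mono[OF TK, of n] n by simp
    have "real K0 * 1 \<le> real (T div n) * (real n)\<^sup>2"
      using K n by (intro mult_mono) auto
    then have "C / (real (T div n) * (real n)\<^sup>2) \<le> C / (real K0 * 1)"
      using C K0(1) by (intro frac_le) auto
    also have "\<dots> \<le> \<eta>\<^sup>2"
      using K0 \<eta> by (simp add: field_simps)
    finally have first: "C / (real (T div n) * (real n)\<^sup>2) \<le> \<eta>\<^sup>2" .
    have "2 * real n / \<eta> \<le> real T"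
      using T unfolding T1_def by linarith
    then have last: "2 * real n / real T \<le> \<eta>"
      using \<eta> n nT by (simp add: field_simps)
    obtain \<pi> where \<pi>: "\<pi> \<in> plans" and "\<forall>i<J. (\<integral>s. \<bar>cost (q i) T \<pi> y s / real T - (\<integral>x. q i x \<partial>\<gamma>)\<bar> \<partial>P) \<le>
        \<eta> + (C / (real (T div n) * (real n)\<^sup>2) + 4 * real J * (e + 1) / real n) / \<eta> + 2 * real n / real T"
      using stationary_average_plan[where J=J and q=q and v="\<lambda>i. \<integral>x. q i x \<partial>\<gamma>",
          OF q_continuous q_bound \<gamma> refl integral_q_bound[OF \<gamma>] appr' y n nT \<eta>]
      unfolding C_def by blast
    moreover have "(C / (real (T div n) * (real n)\<^sup>2) + 4 * real J * (e + 1) / real n) / \<eta> \<le> (\<eta>\<^sup>2 + \<eta>\<^sup>2) / \<eta>"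
      using first e \<eta> by (intro divide_right_mono add_mono) auto
    moreover have "(\<eta>\<^sup>2 + \<eta>\<^sup>2) / \<eta> = 2 * \<eta>"
      using \<eta> by (simp add: power2_eq_square)
    ultimately have le: "(\<integral>s. \<bar>cost (q i) T \<pi> y s / real T - (\<integral>x. q i x \<partial>\<gamma>)\<bar> \<partial>P) \<le> 4 * \<eta>" if "i < J" for i
      using last that by fastforce
    have "rho_E M q \<gamma> (occupational_measures Y U S f \<sigma> T y) \<le>
        (\<Sum>j<J. (1/2) ^ Suc j * (\<integral>s. \<bar>cost (q j) T \<pi> y s / real T - (\<integral>x. q j x \<partial>\<gamma>)\<bar> \<partial>P)) + 2 * (1/2) ^ J"
      using rho_E_le[OF \<gamma> \<pi> y] n nT by simp
    also have "\<dots> \<le> (\<Sum>j<J. (1/2) ^ Suc j * (4 * \<eta>)) + \<epsilon> / 2"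
      using le J(2) by (intro add_mono sum_mono mult_left_mono) auto
    also have "\<dots> = (\<Sum>j<J. (1/2) ^ Suc j) * (4 * \<eta>) + \<epsilon> / 2"
      by (simp add: sum_distrib_right)
    also have "\<dots> \<le> 1 * (4 * \<eta>) + \<epsilon> / 2"
      using \<eta> by (intro add_mono mult_right_mono halves_sum_le) auto
    also have "\<dots> = \<epsilon>"
      by (simp add: \<eta>_def)
    finally show "rho_E M q \<gamma> (occupational_measures Y U S f \<sigma> T y) \<le> \<epsilon>" .
  qed
qed

text \<open>Truncation at \<open>J = 0\<close> leaves only the tail bound 2, for any constant plan.
  This makes the supremum that defines the final rate finite.\<close>

lemma rho_E_le_2:
  assumes "\<gamma> \<in> stationary_measures Y U \<mu> f" "y \<in> Y" "T > 0"
  shows "rho_E M q \<gamma> (occupational_measures Y U S f \<sigma> T y) \<le> 2"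
proof -
  obtain u where "u \<in> U" using nonempty by blast
  then show ?thesis
    using rho_E_le[OF assms(1) const_plan assms(2,3), of u 0] by simp
qed

end

theorem corollary4p3:
  fixes Y :: "(real ^ 'm) set"
    and U :: "'u::metric_space set"
    and S :: "'s::metric_space set"
    and f :: "(real ^ 'm) \<times> 'u \<times> 's \<Rightarrow> real ^ 'm"
    and M :: "'w measure"
    and \<sigma> :: "nat \<Rightarrow> 'w \<Rightarrow> 's"
    and \<mu> :: "'s measure"
    and q :: "nat \<Rightarrow> (real ^ 'm) \<times> 'u \<Rightarrow> real"
  assumes "compact Y" and "compact U" and "compact S"
    and "continuous_on (Y \<times> U \<times> S) f"
    and "\<And>y u s. y \<in> Y \<Longrightarrow> u \<in> U \<Longrightarrow> s \<in> S \<Longrightarrow> f (y, u, s) \<in> Y"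
    and "prob_space M"
    and "prob_space.indep_vars M (\<lambda>_. borel_on S) \<sigma> UNIV"
    and "\<And>t. distr M (borel_on S) (\<sigma> t) = \<mu>"
    and "dense_Lipschitz_sequence (Y \<times> U) q"
    and "\<And>j. j \<ge> 1 \<Longrightarrow> strong_approximation M Y U S f \<sigma> j q"
  shows "\<exists>\<nu>::nat \<Rightarrow> real. \<nu> \<longlonglongrightarrow> 0 \<and>
    (\<forall>T\<ge>1. \<forall>y0\<in>Y.
       (SUP \<gamma>\<in>stationary_measures Y U \<mu> f.
          ereal (rho_E M q \<gamma> (occupational_measures Y U S f \<sigma> T y0))) \<le> ereal (\<nu> T))"
proof (cases "stationary_measures Y U \<mu> f = {}")
  case True
  \<comment> \<open>The supremum over the empty set is minus infinity in \<open>ereal\<close>, so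
    the zero function is a bound.\<close>
  then show ?thesis
    by (intro exI[of _ "\<lambda>_. 0"]) (auto simp: bot_ereal_def)
next
  case False
  then obtain \<gamma>0 where "prob_space \<gamma>0" "sets \<gamma>0 = sets (borel_on (Y \<times> U))"
    by (auto simp: stationary_measures_def)
  \<comment> \<open>A stationary probability measure exists in this case, which yields the
    nonemptiness that the locale asks for.\<close>
  then have "Y \<times> U \<noteq> {}"
    using prob_space.not_empty[of \<gamma>0] sets_eq_imp_space_eq[of \<gamma>0 "borel_on (Y \<times> U)"] by simp
  then have ne: "Y \<noteq> {}" "U \<noteq> {}"
    by auto
  interpret M: prob_space M by fact
  have "\<sigma> 0 \<in> measurable M (borel_on S)"
    using assms(7) unfolding M.indep_vars_def by blast
  then have \<mu>: "prob_space \<mu>"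
    using M.prob_space_distr assms(8)[of 0] by metis
  have sets_\<mu>: "sets \<mu> = sets (borel_on S)"
    using assms(8)[of 0] sets_distr by metis
  interpret driven_system Y U S f \<mu> M \<sigma> q
    by (intro driven_system.intro control_system.intro driven_system_axioms.intro \<mu> sets_\<mu> ne assms(1-9))
  let ?W = "stationary_measures Y U \<mu> f"
  let ?r = "\<lambda>T (\<gamma>, y). rho_E M q \<gamma> (occupational_measures Y U S f \<sigma> T y)"
  \<comment> \<open>The supremum runs over \<gamma> and the initial state together, so one rate
    serves all of them. Inserting 0 makes the rate nonnegative and the set nonempty; boundedness is
    available from \<open>T \<ge> 1\<close> on.\<close>
  define \<nu> where "\<nu> T = Sup (insert 0 (?r T ` (?W \<times> Y)))" for T
  have bdd: "bdd_above (insert 0 (?r T ` (?W \<times> Y)))" if "T \<ge> 1" for T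
    using rho_E_le_2 that by (intro bdd_aboveI[where M=2]) auto
  have "\<nu> \<longlonglongrightarrow> 0"
  proof (rule LIMSEQ_I)
    fix e :: real assume "0 < e"
    then have "e / 2 > 0" by simp
    obtain T1 where T1: "\<And>T \<gamma> y. T \<ge> T1 \<Longrightarrow> \<gamma> \<in> ?W \<Longrightarrow> y \<in> Y \<Longrightarrow> ?r T (\<gamma>, y) \<le> e / 2"
      using rho_E_uniformly_small[OF assms(10) \<open>e / 2 > 0\<close>] by auto
    have "norm (\<nu> T - 0) < e" if "T \<ge> max 1 T1" for T
    proof -
      have "0 \<le> \<nu> T"
        unfolding \<nu>_def using that by (intro cSup_upper bdd) auto
      moreover have "\<nu> T \<le> e / 2"
        unfolding \<nu>_def using that T1 \<open>0 < e\<close> by (intro cSup_least) auto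
      ultimately show ?thesis using \<open>0 < e\<close> by simp
    qed
    then show "\<exists>n0. \<forall>n\<ge>n0. norm (\<nu> n - 0) < e" by blast
  qed
  moreover have "(SUP \<gamma>\<in>?W. ereal (rho_E M q \<gamma> (occupational_measures Y U S f \<sigma> T y0))) \<le> ereal (\<nu> T)"
    if "T \<ge> 1" "y0 \<in> Y" for T y0
  proof (rule SUP_least)
    fix \<gamma> assume "\<gamma> \<in> ?W"
    then have "?r T (\<gamma>, y0) \<le> \<nu> T"
      unfolding \<nu>_def using that by (intro cSup_upper bdd) auto
    then show "ereal (rho_E M q \<gamma> (occupational_measures Y U S f \<sigma> T y0)) \<le> ereal (\<nu> T)"
      by simp
  qed
  ultimately show ?thesis by blast
qed

end
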